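(* Consider the structured switched linear system $\dot x(t)=A_{\sigma(t)}x(t)+B_{\sigma(t)}u_{\sigma(t)}(t)$ with structured matrices $(A_i,B_i)_{i=1}^N$. If its colored union graph $\mathcal G_c$ contains a collection of vertex-disjoint generalized stems and generalized buds that cover $X$, then the system is structurally controllable.
   Context: System: $x(t)\in\mathbb R^n$, switching signal $\sigma:[0,\infty)\to[N]=\{1,\dots,N\}$ (designable), piecewise continuous input $u_{\sigma(t)}(t)\in\mathbb R^{m_{\sigma(t)}}$, $A_i$ of size $n\times n$, $B_i$ of size $n\times m_i$. A state $x$ is controllable if there exist finite $t_f$, a switching signal $\sigma:[0,t_f)\to[N]$ and an input such that $x(0)=x$, $x(t_f)=0$; the system is controllable if every state in $\mathbb R^n$ is controllable. A structured matrix has entries that are either fixed zero or independent free real parameters (nonzero entries); a realization assigns real values to the free entries. The structured system is structurally controllable if some realization $(\tilde A_i,\tilde B_i)_{i=1}^N$ is controllable. Colored union graph $\mathcal G_c$: vertices $X=\{x_1,\dots,x_n\}$ and $U=\bigcup_iU_i$, $U_i=\{u^i_1,\dots,u^i_{m_i}\}$; for each $i$ and each nonzero entry $(j,k)$ of $A_i$ a state edge $(x_k,x_j)$ with color index $i$ (parallel edges of different colors allowed); for each nonzero entry $(j,k)$ of $B_i$ an input edge $(u^i_k,x_j)$ with color index $i$. A state vertex is input-reachable if some path from a vertex of $U$ reaches it. A set of edges is S-disjoint if their heads are all distinct and edges with the same tail have different color indices. A cycle is a closed walk whose only repeated vertex is its start/end (self-loops allowed). Generalized stem: a subgraph $(V_s,E_s)$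 of $\mathcal G_c$ with exactly one input vertex in $V_s$ and no cycle, each state vertex of $V_s$ having exactly one ingoing edge in $E_s$, and with $E_s$ S-disjoint. Generalized bud: a subgraph $(V_s,E_s)$ with no input vertex and exactly one cycle, every state vertex of $V_s$ input-reachable in $\mathcal G_c$, each state vertex of $V_s$ having exactly one ingoing edge in $E_s$, and with $E_s$ S-disjoint. A collection of subgraphs covers $X$ if every vertex of $X$ lies in one of them. *)

theory Defs
  imports "HOL-Analysis.Analysis"
begin

text \<open>
  State index type 'n (finite), so states live in real^'n.  Modes are 1..N.
  Mode i has m i inputs, indexed 0..<m i.
  A structure is given by the zero patterns
    SA i j k : entry (j,k) of A_i is a free parameter,
    SB i j k : entry (j,k) of B_i is a free parameter (k < m i).
  A realisation: A :: nat => real^'n^'n, B :: nat => 'n => nat => real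
  with B i j k the (j,k) entry of B_i.
\<close>

definition realizes ::
  "nat \<Rightarrow> (nat \<Rightarrow> nat) \<Rightarrow> (nat \<Rightarrow> 'n::finite \<Rightarrow> 'n \<Rightarrow> bool) \<Rightarrow> (nat \<Rightarrow> 'n \<Rightarrow> nat \<Rightarrow> bool)
   \<Rightarrow> (nat \<Rightarrow> real^'n^'n) \<Rightarrow> (nat \<Rightarrow> 'n \<Rightarrow> nat \<Rightarrow> real) \<Rightarrow> bool" where
  "realizes N m SA SB A B \<longleftrightarrow>
     (\<forall>i\<in>{1..N}. \<forall>j k. \<not> SA i j k \<longrightarrow> A i $ j $ k = 0) \<and>
     (\<forall>i\<in>{1..N}. \<forall>j. \<forall>k<m i. \<not> SB i j k \<longrightarrow> B i j k = 0)"

definition inp_vec :: "(nat \<Rightarrow> nat) \<Rightarrow> (nat \<Rightarrow> 'n::finite \<Rightarrow> nat \<Rightarrow> real) \<Rightarrow> nat \<Rightarrow> (nat \<Rightarrow> real) \<Rightarrow> real^'n" where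
  "inp_vec m B i v = (\<chi> j. \<Sum>k<m i. B i j k * v k)"

text \<open>
  A state x0 is controllable: there is a finite final time tf, a switching signal
  sigma (piecewise constant with values in 1..N on [0,tf)), a piecewise continuous
  input u (with finitely many discontinuities and continuous extensions to the closed
  pieces), and a (continuous, piecewise C^1) solution x of
  x' = A_sigma x + B_sigma u_sigma with x 0 = x0 and x tf = 0.
  The partition 0 = ts 0 < ts 1 < ... < ts K = tf contains all switching instants
  and all discontinuities of the input.
\<close>

definition controllable_state ::
  "nat \<Rightarrow> (nat \<Rightarrow> nat) \<Rightarrow> (nat \<Rightarrow> real^'n^'n) \<Rightarrow> (nat \<Rightarrow> 'n::finite \<Rightarrow> nat \<Rightarrow> real) \<Rightarrow> real^'n \<Rightarrow> bool" where
  "controllable_state N m A B x0 \<longleftrightarrow>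
    (\<exists>tf::real. \<exists>K::nat. \<exists>ts::nat \<Rightarrow> real. \<exists>\<sigma>::real \<Rightarrow> nat.
     \<exists>u::real \<Rightarrow> nat \<Rightarrow> real. \<exists>x::real \<Rightarrow> real^'n.
       0 \<le> tf \<and> ts 0 = 0 \<and> ts K = tf \<and> (\<forall>k<K. ts k < ts (Suc k)) \<and>
       (\<forall>t\<in>{0..<tf}. \<sigma> t \<in> {1..N}) \<and>
       (\<forall>k<K. \<exists>c. \<forall>t\<in>{ts k<..<ts (Suc k)}. \<sigma> t = c) \<and>
       (\<forall>k<K. \<forall>l. \<exists>g::real \<Rightarrow> real. continuous_on {ts k..ts (Suc k)} g \<and>
                 (\<forall>t\<in>{ts k<..<ts (Suc k)}. u t l = g t)) \<and>
       continuous_on {0..tf} x \<and> x 0 = x0 \<and> x tf = 0 \<and>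
       (\<forall>k<K. \<forall>t\<in>{ts k<..<ts (Suc k)}.
          (x has_vector_derivative (A (\<sigma> t) *v x t + inp_vec m B (\<sigma> t) (u t))) (at t)))"

definition switched_controllable ::
  "nat \<Rightarrow> (nat \<Rightarrow> nat) \<Rightarrow> (nat \<Rightarrow> real^'n^'n) \<Rightarrow> (nat \<Rightarrow> 'n::finite \<Rightarrow> nat \<Rightarrow> real) \<Rightarrow> bool" where
  "switched_controllable N m A B \<longleftrightarrow> (\<forall>x0. controllable_state N m A B x0)"

definition structurally_controllable ::
  "nat \<Rightarrow> (nat \<Rightarrow> nat) \<Rightarrow> (nat \<Rightarrow> 'n::finite \<Rightarrow> 'n \<Rightarrow> bool) \<Rightarrow> (nat \<Rightarrow> 'n \<Rightarrow> nat \<Rightarrow> bool) \<Rightarrow> bool" where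
  "structurally_controllable N m SA SB \<longleftrightarrow>
     (\<exists>A B. realizes N m SA SB A B \<and> switched_controllable N m A B)"

text \<open>Vertices: Inl j is state vertex x_j; Inr (i,k) is input vertex u^i_k.
  Edges are triples (tail, head, color).\<close>

type_synonym 'n vert = "'n + (nat \<times> nat)"
type_synonym 'n cedge = "'n vert \<times> 'n vert \<times> nat"

definition etail :: "'n cedge \<Rightarrow> 'n vert" where "etail e = fst e"
definition ehead :: "'n cedge \<Rightarrow> 'n vert" where "ehead e = fst (snd e)"
definition ecolor :: "'n cedge \<Rightarrow> nat" where "ecolor e = snd (snd e)"

definition state_verts :: "'n vert set" where "state_verts = range Inl"

definition input_verts :: "nat \<Rightarrow> (nat \<Rightarrow> nat) \<Rightarrow> 'n vert set" where
  "input_verts N m = {Inr (i,k) | i k. i \<in> {1..N} \<and> k < m i}"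

definition Gc_verts :: "nat \<Rightarrow> (nat \<Rightarrow> nat) \<Rightarrow> 'n vert set" where
  "Gc_verts N m = state_verts \<union> input_verts N m"

definition Gc_edges ::
  "nat \<Rightarrow> (nat \<Rightarrow> nat) \<Rightarrow> (nat \<Rightarrow> 'n \<Rightarrow> 'n \<Rightarrow> bool) \<Rightarrow> (nat \<Rightarrow> 'n \<Rightarrow> nat \<Rightarrow> bool) \<Rightarrow> 'n cedge set" where
  "Gc_edges N m SA SB =
     {(Inl k, Inl j, i) | i j k. i \<in> {1..N} \<and> SA i j k} \<union>
     {(Inr (i,k), Inl j, i) | i j k. i \<in> {1..N} \<and> k < m i \<and> SB i j k}"

definition input_reachable ::
  "nat \<Rightarrow> (nat \<Rightarrow> nat) \<Rightarrow> (nat \<Rightarrow> 'n \<Rightarrow> 'n \<Rightarrow> bool) \<Rightarrow> (nat \<Rightarrow> 'n \<Rightarrow> nat \<Rightarrow> bool) \<Rightarrow> 'n vert \<Rightarrow> bool" where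
  "input_reachable N m SA SB v \<longleftrightarrow>
     (\<exists>w\<in>input_verts N m. (w, v) \<in> {(etail e, ehead e) | e. e \<in> Gc_edges N m SA SB}\<^sup>+)"

definition S_disjoint :: "'n cedge set \<Rightarrow> bool" where
  "S_disjoint Es \<longleftrightarrow>
     (\<forall>e1\<in>Es. \<forall>e2\<in>Es. e1 \<noteq> e2 \<longrightarrow> ehead e1 \<noteq> ehead e2) \<and>
     (\<forall>e1\<in>Es. \<forall>e2\<in>Es. e1 \<noteq> e2 \<and> etail e1 = etail e2 \<longrightarrow> ecolor e1 \<noteq> ecolor e2)"

text \<open>A cycle in Es: a nonempty closed walk given as an edge list, whose vertices
  (the tails) are pairwise distinct; identified by its edge set (so rotations coincide).\<close>

definition is_cycle :: "'n cedge set \<Rightarrow> 'n cedge list \<Rightarrow> bool" where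
  "is_cycle Es es \<longleftrightarrow> es \<noteq> [] \<and> set es \<subseteq> Es \<and>
     (\<forall>i<length es. ehead (es ! i) = etail (es ! ((Suc i) mod length es))) \<and>
     distinct (map etail es)"

definition cycles :: "'n cedge set \<Rightarrow> 'n cedge set set" where
  "cycles Es = {set es | es. is_cycle Es es}"

definition is_subgraph ::
  "nat \<Rightarrow> (nat \<Rightarrow> nat) \<Rightarrow> (nat \<Rightarrow> 'n \<Rightarrow> 'n \<Rightarrow> bool) \<Rightarrow> (nat \<Rightarrow> 'n \<Rightarrow> nat \<Rightarrow> bool)
   \<Rightarrow> 'n vert set \<Rightarrow> 'n cedge set \<Rightarrow> bool" where
  "is_subgraph N m SA SB Vs Es \<longleftrightarrow> Vs \<subseteq> Gc_verts N m \<and> Es \<subseteq> Gc_edges N m SA SB \<and>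
     (\<forall>e\<in>Es. etail e \<in> Vs \<and> ehead e \<in> Vs)"

definition one_ingoing :: "'n vert set \<Rightarrow> 'n cedge set \<Rightarrow> bool" where
  "one_ingoing Vs Es \<longleftrightarrow> (\<forall>v\<in>Vs \<inter> state_verts. \<exists>!e. e \<in> Es \<and> ehead e = v)"

definition gen_stem ::
  "nat \<Rightarrow> (nat \<Rightarrow> nat) \<Rightarrow> (nat \<Rightarrow> 'n \<Rightarrow> 'n \<Rightarrow> bool) \<Rightarrow> (nat \<Rightarrow> 'n \<Rightarrow> nat \<Rightarrow> bool)
   \<Rightarrow> 'n vert set \<Rightarrow> 'n cedge set \<Rightarrow> bool" where
  "gen_stem N m SA SB Vs Es \<longleftrightarrow> is_subgraph N m SA SB Vs Es \<and>
     (\<exists>!w. w \<in> Vs \<inter> input_verts N m) \<and> cycles Es = {} \<and>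
     one_ingoing Vs Es \<and> S_disjoint Es"

definition gen_bud ::
  "nat \<Rightarrow> (nat \<Rightarrow> nat) \<Rightarrow> (nat \<Rightarrow> 'n \<Rightarrow> 'n \<Rightarrow> bool) \<Rightarrow> (nat \<Rightarrow> 'n \<Rightarrow> nat \<Rightarrow> bool)
   \<Rightarrow> 'n vert set \<Rightarrow> 'n cedge set \<Rightarrow> bool" where
  "gen_bud N m SA SB Vs Es \<longleftrightarrow> is_subgraph N m SA SB Vs Es \<and>
     Vs \<inter> input_verts N m = {} \<and> (\<exists>!C. C \<in> cycles Es) \<and>
     (\<forall>v\<in>Vs \<inter> state_verts. input_reachable N m SA SB v) \<and>
     one_ingoing Vs Es \<and> S_disjoint Es"

end

theory Submission
  imports Defs "HOL-Computational_Algebra.Fundamental_Theorem_Algebra"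
begin

text \<open>
  Only two consequences of the covering are needed: every state is input-reachable, and every state
  \<open>l\<close> has an ingoing edge (its parent edge) such that distinct states use distinct pairs of tail and
  color.

  A switched system is controllable as soon as no proper subspace is invariant under all \<open>A\<^sub>i\<close>
  and contains the images of all \<open>B\<^sub>i\<close>: along a switching schedule whose reachable subspace has maximal
  dimension, prolonging the schedule only transports that subspace by the flows, and the intersection of all
  these transports is invariant.

  For the realization, give the parent edges fixed weights and add a few extra edges whose weights are powers of
  a small \<open>s > 0\<close>. Assume that for every \<open>s\<close> there is a nonzero space of functionals that kills the inputs and is
  invariant under all modes. Conjugation by powers of \<open>s\<close> gives the sum of all modes another
  limit, in which every nonzero mode is controllable; hence the eigenvalues of that sum on the
  bad functionals tend to \<open>0\<close>, and it is nilpotent on their limits as \<open>s\<close> tends to \<open>0\<close>. But the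
  limits are invariant under the modes made of parent edges only, and following parents backwards, color
  by color, moves such a functional either to an input, which is impossible, or onto the cycles of
  the parent map, where the sum of all modes is injective.
\<close>

subsection \<open>Flows of linear vector fields\<close>

text \<open>A copy of the operator space that is a Banach algebra, so that \<open>exp\<close> applies to it.\<close>

typedef (overloaded) 'a endo = "UNIV :: ('a::euclidean_space \<Rightarrow>\<^sub>L 'a) set"
  morphisms blinfun_of_endo Endo
  by simp

setup_lifting type_definition_endo

instantiation endo :: (euclidean_space) real_normed_algebra_1
begin

lift_definition zero_endo :: "'a endo" is "0 :: 'a \<Rightarrow>\<^sub>L 'a" .
lift_definition one_endo :: "'a endo" is "id_blinfun :: 'a \<Rightarrow>\<^sub>L 'a" .
lift_definition plus_endo :: "'a endo \<Rightarrow> 'a endo \<Rightarrow> 'a endo" is "(+)" .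
lift_definition minus_endo :: "'a endo \<Rightarrow> 'a endo \<Rightarrow> 'a endo" is "(-)" .
lift_definition uminus_endo :: "'a endo \<Rightarrow> 'a endo" is "uminus" .
lift_definition times_endo :: "'a endo \<Rightarrow> 'a endo \<Rightarrow> 'a endo" is "(o\<^sub>L)" .
lift_definition scaleR_endo :: "real \<Rightarrow> 'a endo \<Rightarrow> 'a endo" is "(*\<^sub>R)" .
lift_definition norm_endo :: "'a endo \<Rightarrow> real" is "norm" .

definition dist_endo :: "'a endo \<Rightarrow> 'a endo \<Rightarrow> real" where
  "dist_endo f g = norm (f - g)"
definition sgn_endo :: "'a endo \<Rightarrow> 'a endo" where
  "sgn_endo f = inverse (norm f) *\<^sub>R f"
definition uniformity_endo :: "('a endo \<times> 'a endo) filter" where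
  "uniformity_endo = (INF e\<in>{0<..}. principal {(f, g). dist f g < e})"
definition open_endo :: "'a endo set \<Rightarrow> bool" where
  "open_endo S = (\<forall>f\<in>S. \<forall>\<^sub>F (f', g) in uniformity. f' = f \<longrightarrow> g \<in> S)"

instance
proof
  fix f g h :: "'a endo" and a b :: real
  show "f + g + h = f + (g + h)" "f + g = g + f" "0 + f = f" "- f + f = 0" "f - g = f + - g"
    by (transfer; simp)+
  show "a *\<^sub>R (f + g) = a *\<^sub>R f + a *\<^sub>R g" "(a + b) *\<^sub>R f = a *\<^sub>R f + b *\<^sub>R f"
    "a *\<^sub>R b *\<^sub>R f = (a * b) *\<^sub>R f" "1 *\<^sub>R f = f"
    by (transfer; simp add: scaleR_add_right scaleR_add_left)+
  show "f * g * h = f * (g * h)" "1 * f = f" "f * 1 = f"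
    by (transfer; simp add: blinfun_eqI)+
  show "(f + g) * h = f * h + g * h" "f * (g + h) = f * g + f * h"
    by (transfer; simp add: blinfun.add_left blinfun.add_right blinfun_eqI)+
  show "a *\<^sub>R f * g = a *\<^sub>R (f * g)" "f * a *\<^sub>R g = a *\<^sub>R (f * g)"
    by (transfer; simp add: blinfun.scaleR_left blinfun.scaleR_right blinfun_eqI)+
  show "(0::'a endo) \<noteq> 1"
  proof transfer
    obtain e :: 'a where "e \<in> Basis" using nonempty_Basis by blast
    then show "(0 :: 'a \<Rightarrow>\<^sub>L 'a) \<noteq> id_blinfun"
      by (metis blinfun.zero_left blinfun_apply_id_blinfun id_apply nonzero_Basis)
  qed
  show "(norm f = 0) = (f = 0)" "norm (f + g) \<le> norm f + norm g"
    "norm (a *\<^sub>R f) = \<bar>a\<bar> * norm f"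
    by (transfer; simp add: norm_triangle_ineq)+
  show "norm (f * g) \<le> norm f * norm g"
    by transfer (rule norm_blinfun_compose)
  show "norm (1 :: 'a endo) = 1"
    by transfer (simp add: norm_blinfun_id)
qed (simp_all add: dist_endo_def sgn_endo_def uniformity_endo_def open_endo_def)

end

instance endo :: (euclidean_space) banach
proof
  fix X :: "nat \<Rightarrow> 'a endo"
  assume X: "Cauchy X"
  have dist: "dist f g = dist (blinfun_of_endo f) (blinfun_of_endo g)" for f g :: "'a endo"
    by (simp add: dist_endo_def dist_norm norm_endo.rep_eq minus_endo.rep_eq)
  have "Cauchy (\<lambda>n. blinfun_of_endo (X n))"
    using X by (simp add: Cauchy_def dist)
  then obtain L where "(\<lambda>n. blinfun_of_endo (X n)) \<longlonglongrightarrow> L"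
    using Cauchy_convergent convergent_def by blast
  then have "X \<longlonglongrightarrow> Endo L"
    by (simp add: lim_sequentially dist Endo_inverse)
  then show "convergent X"
    by (auto simp: convergent_def)
qed

lemma bounded_bilinear_apply_endo:
  "bounded_bilinear (\<lambda>f x. blinfun_apply (blinfun_of_endo f) x)"
proof
  fix f g :: "'a endo" and x y :: 'a and r :: real
  show "blinfun_of_endo (f + g) x = blinfun_of_endo f x + blinfun_of_endo g x"
    by (simp add: plus_endo.rep_eq blinfun.add_left)
  show "blinfun_of_endo (r *\<^sub>R f) x = r *\<^sub>R blinfun_of_endo f x"
    by (simp add: scaleR_endo.rep_eq blinfun.scaleR_left)
  show "blinfun_of_endo f (x + y) = blinfun_of_endo f x + blinfun_of_endo f y"
    by (simp add: blinfun.add_right)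
  show "blinfun_of_endo f (r *\<^sub>R x) = r *\<^sub>R blinfun_of_endo f x"
    by (simp add: blinfun.scaleR_right)
  show "\<exists>K. \<forall>f (x::'a). norm (blinfun_of_endo f x) \<le> norm f * norm x * K"
    by (rule exI[of _ 1]) (simp add: norm_endo.rep_eq norm_blinfun)
qed

text \<open>The last clause is the product rule for a moving argument: with constant
  \<open>w\<close> it is the differential equation, and with an integral for \<open>w\<close> it
  yields variation of constants.\<close>

definition is_flow :: "('a::real_normed_vector \<Rightarrow> 'a) \<Rightarrow> (real \<Rightarrow> 'a \<Rightarrow> 'a) \<Rightarrow> bool" where
  "is_flow L F \<longleftrightarrow> (\<forall>t. linear (F t)) \<and> (\<forall>x. F 0 x = x) \<and> (\<forall>t x. F (- t) (F t x) = x) \<and>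
    (\<forall>t S w w'. (w has_vector_derivative w') (at t within S) \<longrightarrow>
      ((\<lambda>t. F t (w t)) has_vector_derivative (L (F t (w t)) + F t w')) (at t within S))"

lemma linear_flow_exists:
  fixes L :: "'a::euclidean_space \<Rightarrow> 'a"
  assumes "linear L"
  shows "\<exists>F. is_flow L F"
proof -
  define E where "E = Endo (Blinfun L)"
  have bl: "bounded_linear L"
    using assms linear_conv_bounded_linear by blast
  have apE: "blinfun_of_endo E x = L x" for x
    by (simp add: E_def Endo_inverse bounded_linear_Blinfun_apply[OF bl])
  \<comment> \<open>The operator exponential; the derivative clause is the product rule for the
    bilinear evaluation map.\<close>
  define F where "F t x = blinfun_of_endo (exp (t *\<^sub>R E)) x" for t x
  have mult: "blinfun_of_endo (f * g) x = blinfun_of_endo f (blinfun_of_endo g x)" for f g x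
    by (simp add: times_endo.rep_eq)
  show ?thesis
    unfolding is_flow_def
  proof (intro exI[of _ F] conjI allI impI)
    show "linear (F t)" for t
      unfolding F_def using blinfun.bounded_linear_right bounded_linear.linear by blast
    show "F 0 x = x" for x
      by (simp add: F_def one_endo.rep_eq)
    show "F (- t) (F t x) = x" for t x
    proof -
      have "exp (- t *\<^sub>R E) * exp (t *\<^sub>R E) = 1"
        using exp_minus_inverse[of "- t *\<^sub>R E"] by simp
      then show ?thesis
        by (simp add: F_def mult[symmetric] one_endo.rep_eq)
    qed
    show "((\<lambda>t. F t (w t)) has_vector_derivative (L (F t (w t)) + F t w')) (at t within S)"
      if "(w has_vector_derivative w') (at t within S)" for t S w w'
    proof -
      have "((\<lambda>t. exp (t *\<^sub>R E)) has_vector_derivative E * exp (t *\<^sub>R E)) (at t within S)"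
        using exp_scaleR_has_vector_derivative_left has_vector_derivative_at_within by blast
      from bounded_bilinear.has_vector_derivative[OF bounded_bilinear_apply_endo this that]
      show ?thesis
        by (simp add: F_def mult apE add.commute)
    qed
  qed
qed

subsection \<open>Controllability from invariant subspaces\<close>

text \<open>This is \<open>controllable_state\<close> with a free end state, so that trajectories
  can be prolonged step by step.\<close>

definition transfers ::
  "nat \<Rightarrow> (nat \<Rightarrow> nat) \<Rightarrow> (nat \<Rightarrow> real^'n^'n) \<Rightarrow> (nat \<Rightarrow> 'n::finite \<Rightarrow> nat \<Rightarrow> real)
    \<Rightarrow> real^'n \<Rightarrow> real^'n \<Rightarrow> bool" where
  "transfers N m A B x0 x1 \<longleftrightarrow>
    (\<exists>tf::real. \<exists>K::nat. \<exists>ts::nat \<Rightarrow> real. \<exists>\<sigma>::real \<Rightarrow> nat.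
     \<exists>u::real \<Rightarrow> nat \<Rightarrow> real. \<exists>x::real \<Rightarrow> real^'n.
       0 \<le> tf \<and> ts 0 = 0 \<and> ts K = tf \<and> (\<forall>k<K. ts k < ts (Suc k)) \<and>
       (\<forall>t\<in>{0..<tf}. \<sigma> t \<in> {1..N}) \<and>
       (\<forall>k<K. \<exists>c. \<forall>t\<in>{ts k<..<ts (Suc k)}. \<sigma> t = c) \<and>
       (\<forall>k<K. \<forall>l. \<exists>g::real \<Rightarrow> real. continuous_on {ts k..ts (Suc k)} g \<and>
                 (\<forall>t\<in>{ts k<..<ts (Suc k)}. u t l = g t)) \<and>
       continuous_on {0..tf} x \<and> x 0 = x0 \<and> x tf = x1 \<and>
       (\<forall>k<K. \<forall>t\<in>{ts k<..<ts (Suc k)}.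
          (x has_vector_derivative (A (\<sigma> t) *v x t + inp_vec m B (\<sigma> t) (u t))) (at t)))"

lemma controllable_state_iff_transfers:
  "controllable_state N m A B x0 \<longleftrightarrow> transfers N m A B x0 0"
  unfolding controllable_state_def transfers_def ..

lemma transfers_refl: "transfers N m A B x x"
  unfolding transfers_def
  by (rule exI[of _ 0], rule exI[of _ 0], rule exI[of _ "\<lambda>_. 0"], rule exI[of _ "\<lambda>_. 0"],
      rule exI[of _ "\<lambda>_ _. 0"], rule exI[of _ "\<lambda>_. x"]) auto

text \<open>One piece with constant mode and constant input is glued on, shifted in time by
  \<open>tf\<close>. Derivatives are required only inside the pieces, so the trajectory may have a
  kink at the joint.\<close>

lemma transfers_step:
  assumes tr: "transfers N m A B x0 x1" and i: "i \<in> {1..N}" and h: "0 < h"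
    and ycont: "continuous_on {0..h} y" and y0: "y 0 = x1"
    and yder: "\<And>t. t \<in> {0<..<h} \<Longrightarrow>
      (y has_vector_derivative (A i *v y t + inp_vec m B i v)) (at t)"
  shows "transfers N m A B x0 (y h)"
proof -
  obtain tf K ts \<sigma> u x where
    tf: "0 \<le> tf" and ts0: "ts 0 = (0::real)" and tsK: "ts K = tf"
    and tsm: "\<And>k. k < K \<Longrightarrow> ts k < ts (Suc k)"
    and sg: "\<And>t. t\<in>{0..<tf} \<Longrightarrow> \<sigma> t \<in> {1..N}"
    and sc: "\<And>k. k < K \<Longrightarrow> \<exists>c. \<forall>t\<in>{ts k<..<ts (Suc k)}. \<sigma> t = c"
    and uc: "\<And>k l. k < K \<Longrightarrow> \<exists>g::real \<Rightarrow> real. continuous_on {ts k..ts (Suc k)} g \<and>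
                 (\<forall>t\<in>{ts k<..<ts (Suc k)}. u t l = g t)"
    and xc: "continuous_on {0..tf} x" and x0: "x 0 = x0" and x1: "x tf = x1"
    and xd: "\<And>k t. k < K \<Longrightarrow> t\<in>{ts k<..<ts (Suc k)} \<Longrightarrow>
          (x has_vector_derivative (A (\<sigma> t) *v x t + inp_vec m B (\<sigma> t) (u t))) (at t)"
    using tr unfolding transfers_def by blast
  have le_tf: "ts k \<le> tf" if "k \<le> K" for k
  proof -
    have "ts k \<le> ts K"
      using that
      by (induction rule: inc_induct) (use tsm in \<open>force intro: less_imp_le order_trans\<close>)+
    then show ?thesis using tsK by simp
  qed
  define ts' where "ts' k = (if k \<le> K then ts k else tf + h)" for k
  \<comment> \<open>The strict test hands \<open>t = tf\<close> to the new mode, because the old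
    signal is known to lie in \<open>{1..N}\<close> only before \<open>tf\<close>.\<close>
  define \<sigma>' where "\<sigma>' t = (if t < tf then \<sigma> t else i)" for t
  define u' where "u' t = (if t < tf then u t else v)" for t
  define x' where "x' t = (if t \<le> tf then x t else y (t - tf))" for t
  have old: "ts' k = ts k" "ts' (Suc k) = ts (Suc k)" "ts (Suc k) \<le> tf" if "k < K" for k
    using that le_tf[of "Suc k"] by (auto simp: ts'_def)
  have new: "ts' K = tf" "ts' (Suc K) = tf + h"
    by (auto simp: ts'_def tsK)
  have cont: "continuous_on {0..tf + h} x'"
    unfolding x'_def
  proof (rule continuous_on_cases_1)
    have "{t \<in> {0..tf + h}. t \<le> tf} = {0..tf}" using h tf by auto
    then show "continuous_on {t \<in> {0..tf + h}. t \<le> tf} x" using xc by simp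
    have "continuous_on {tf..tf + h} (\<lambda>t. y (t - tf))"
      by (rule continuous_on_compose2[OF ycont]) (auto intro!: continuous_intros)
    moreover have "{t \<in> {0..tf + h}. tf \<le> t} = {tf..tf + h}" using h tf by auto
    ultimately show "continuous_on {t \<in> {0..tf + h}. tf \<le> t} (\<lambda>t. y (t - tf))" by simp
    show "x tf = y (tf - tf)" using x1 y0 by simp
  qed
  have der: "(x' has_vector_derivative (A (\<sigma>' t) *v x' t + inp_vec m B (\<sigma>' t) (u' t))) (at t)"
    if k: "k < Suc K" and t: "t \<in> {ts' k<..<ts' (Suc k)}" for k t
  proof (cases "k < K")
    case True
    have t': "t \<in> {ts k<..<ts (Suc k)}" "t < tf" using t old[OF True] by auto
    have "(x' has_vector_derivative (A (\<sigma> t) *v x t + inp_vec m B (\<sigma> t) (u t))) (at t)"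
      by (rule has_vector_derivative_transform_within_open[OF xd[OF True t'(1)], of "{..<tf}"])
        (use t' in \<open>auto simp: x'_def\<close>)
    then show ?thesis using t' by (simp add: \<sigma>'_def u'_def x'_def)
  next
    case False
    then have "k = K" using k by simp
    then have t': "tf < t" "t < tf + h" using t new by auto
    have "(y has_vector_derivative (A i *v y (t - tf) + inp_vec m B i v)) (at (t - tf))"
      using yder[of "t - tf"] t' by simp
    then have "((y \<circ> (\<lambda>t. t - tf)) has_vector_derivative
        1 *\<^sub>R (A i *v y (t - tf) + inp_vec m B i v)) (at t)"
      by (intro vector_diff_chain_at) (auto intro!: derivative_eq_intros)
    then have "((\<lambda>t. y (t - tf)) has_vector_derivative
        (A i *v y (t - tf) + inp_vec m B i v)) (at t)"
      by (simp add: o_def)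
    then have "(x' has_vector_derivative (A i *v y (t - tf) + inp_vec m B i v)) (at t)"
      by (rule has_vector_derivative_transform_within_open[of _ _ _ "{tf<..}"])
        (use t' in \<open>auto simp: x'_def\<close>)
    then show ?thesis using t' by (simp add: \<sigma>'_def u'_def x'_def)
  qed
  show ?thesis
    unfolding transfers_def
  proof (rule exI[of _ "tf + h"], rule exI[of _ "Suc K"], rule exI[of _ ts'], rule exI[of _ \<sigma>'],
      rule exI[of _ u'], rule exI[of _ x'], intro conjI ballI allI impI)
    show "0 \<le> tf + h" "ts' 0 = 0" "ts' (Suc K) = tf + h"
      using tf h ts0 by (auto simp: ts'_def)
    show "ts' k < ts' (Suc k)" if "k < Suc K" for k
      using that tsm[of k] h tsK by (cases "k = K") (auto simp: ts'_def)
    show "\<sigma>' t \<in> {1..N}" if "t \<in> {0..<tf + h}" for t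
      using that sg[of t] i by (auto simp: \<sigma>'_def)
    show "\<exists>c. \<forall>t\<in>{ts' k<..<ts' (Suc k)}. \<sigma>' t = c" if "k < Suc K" for k
    proof (cases "k < K")
      case True
      then show ?thesis using sc[OF True] old[OF True] by (auto simp: \<sigma>'_def)
    next
      case False
      then have "k = K" using that by simp
      then show ?thesis using new by (auto simp: \<sigma>'_def)
    qed
    show "\<exists>g. continuous_on {ts' k..ts' (Suc k)} g \<and> (\<forall>t\<in>{ts' k<..<ts' (Suc k)}. u' t l = g t)"
      if "k < Suc K" for k l
    proof (cases "k < K")
      case True
      then show ?thesis using uc[OF True, of l] old[OF True] by (auto simp: u'_def)
    next
      case False
      then have "k = K" using that by simp
      then show ?thesis using new by (auto simp: u'_def intro!: exI[of _ "\<lambda>_. v l"])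
    qed
    show "continuous_on {0..tf + h} x'" by (rule cont)
    show "x' 0 = x0" using x0 tf by (simp add: x'_def)
    show "x' (tf + h) = y h" using h by (simp add: x'_def)
    show "(x' has_vector_derivative (A (\<sigma>' t) *v x' t + inp_vec m B (\<sigma>' t) (u' t))) (at t)"
      if "k < Suc K" "t \<in> {ts' k<..<ts' (Suc k)}" for k t
      using der[OF that] .
  qed
qed

text \<open>A finite-dimensional subspace is closed and therefore contains the limit of the
  difference quotients. The derivative is one-sided because only positive durations occur in
  schedules.\<close>

lemma subspace_contains_derivative_at_right:
  fixes g :: "real \<Rightarrow> 'a::euclidean_space"
  assumes W: "subspace W" and d: "(g has_vector_derivative d) (at 0 within {0..1})"
    and g: "\<And>h. 0 < h \<Longrightarrow> g h - g 0 \<in> W"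
  shows "d \<in> W"
proof (rule Lim_in_closed_set)
  show "closed W" using W by (rule closed_subspace)
  show "(at 0 within {0..1::real}) \<noteq> bot"
    by (simp add: at_within_Icc_at_right)
  show "((\<lambda>h. (g h - g 0) /\<^sub>R (h - 0)) \<longlongrightarrow> d) (at 0 within {0..1})"
    using d unfolding has_vector_derivative_def has_derivative_within
  proof -
    assume *: "bounded_linear (\<lambda>x. x *\<^sub>R d) \<and>
      ((\<lambda>y. (1 / norm (y - 0)) *\<^sub>R (g y - (g 0 + (y - 0) *\<^sub>R d))) \<longlongrightarrow> 0) (at 0 within {0..1})"
    have "((\<lambda>y. (1 / norm (y - 0)) *\<^sub>R (g y - (g 0 + (y - 0) *\<^sub>R d)) + d) \<longlongrightarrow> 0 + d) (at 0 within {0..1})"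
      by (rule tendsto_add) (use * in auto)
    moreover have "\<forall>\<^sub>F y in at 0 within {0..1}. (1 / norm (y - 0)) *\<^sub>R (g y - (g 0 + (y - 0) *\<^sub>R d)) + d
        = (g y - g 0) /\<^sub>R (y - 0)"
      unfolding eventually_at_filter
      by (rule always_eventually) (auto simp: algebra_simps divide_inverse)
    ultimately show ?thesis
      by (simp add: tendsto_cong)
  qed
  show "\<forall>\<^sub>F h in at 0 within {0..1}. (g h - g 0) /\<^sub>R (h - 0) \<in> W"
    unfolding eventually_at_filter
    by (rule always_eventually) (use g W in \<open>auto intro: subspace_mul\<close>)
qed

section \<open>Reachable subspaces of switching schedules\<close>

locale switched_flow =
  fixes N :: nat and m :: "nat \<Rightarrow> nat"
    and A :: "nat \<Rightarrow> real^'n^'n" and B :: "nat \<Rightarrow> 'n::finite \<Rightarrow> nat \<Rightarrow> real"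
    and F :: "nat \<Rightarrow> real \<Rightarrow> real^'n \<Rightarrow> real^'n"
  assumes flow: "is_flow ((*v) (A i)) (F i)"
begin

lemma linear_F: "linear (F i t)" and F_0: "F i 0 x = x" and F_inverse: "F i (- t) (F i t x) = x"
  and F_derivative: "(w has_vector_derivative w') (at t within S) \<Longrightarrow>
      ((\<lambda>t. F i t (w t)) has_vector_derivative (A i *v F i t (w t) + F i t w')) (at t within S)"
  using flow[of i] unfolding is_flow_def by blast+

lemma F_inverse': "F i t (F i (- t) x) = x"
  using F_inverse[of i "- t" x] by simp

lemma inj_F: "inj (F i t)"
  by (metis F_inverse injI)

lemma F_orbit_derivative:
  "((\<lambda>t. F i t x) has_vector_derivative A i *v F i t x) (at t within S)"
  using F_derivative[OF has_vector_derivative_const[of x]]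
  by (simp add: linear_0[OF linear_F])

lemma F_back_derivative:
  "((\<lambda>t. F i (- t) x) has_vector_derivative - (A i *v F i (- t) x)) (at t)"
proof -
  have "(((\<lambda>t. F i t x) \<circ> uminus) has_vector_derivative (- 1) *\<^sub>R (A i *v F i (- t) x)) (at t)"
    by (rule vector_diff_chain_at) (auto intro!: derivative_eq_intros F_orbit_derivative)
  then show ?thesis by (simp add: o_def)
qed

lemma continuous_on_F_back: "continuous_on S (\<lambda>t. F i (- t) x)"
  by (rule continuous_on_vector_derivative)
    (blast intro: has_vector_derivative_at_within F_back_derivative)

text \<open>The variation-of-constants integral pulled back to the start of the step:
  \<open>F i h (x + drift i h b)\<close> is the state at time \<open>h\<close> when mode
  \<open>i\<close> starts in \<open>x\<close> with constant forcing \<open>b\<close>.\<close>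

definition drift :: "nat \<Rightarrow> real \<Rightarrow> real^'n \<Rightarrow> real^'n" where
  "drift i h b = integral {0..h} (\<lambda>t. F i (- t) b)"

lemma drift_derivative:
  "t \<in> {0..h} \<Longrightarrow> ((\<lambda>t. drift i t b) has_vector_derivative F i (- t) b) (at t within {0..h})"
  unfolding drift_def by (rule integral_has_vector_derivative[OF continuous_on_F_back])

lemma integrable_F_back: "(\<lambda>t. F i (- t) b) integrable_on {0..h}"
  by (rule integrable_continuous_real[OF continuous_on_F_back])

lemma linear_drift: "linear (drift i h)"
proof
  show "drift i h (b + c) = drift i h b + drift i h c" for b c
    by (simp add: drift_def linear_add[OF linear_F] integral_add[OF integrable_F_back integrable_F_back])
  show "drift i h (r *\<^sub>R b) = r *\<^sub>R drift i h b" for r b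
    by (simp add: drift_def linear_scale[OF linear_F])
qed

lemma transfers_drift:
  assumes "transfers N m A B x0 x1" "i \<in> {1..N}" "0 < h"
  shows "transfers N m A B x0 (F i h (x1 + drift i h (inp_vec m B i v)))"
proof -
  let ?b = "inp_vec m B i v"
  let ?y = "\<lambda>t. F i t (x1 + drift i t ?b)"
  have d: "(?y has_vector_derivative (A i *v ?y t + ?b)) (at t within {0..h})"
    if "t \<in> {0..h}" for t
  proof -
    have "((\<lambda>t. x1 + drift i t ?b) has_vector_derivative 0 + F i (- t) ?b) (at t within {0..h})"
      by (intro has_vector_derivative_add has_vector_derivative_const drift_derivative that)
    from F_derivative[OF this, of i] show ?thesis by (simp add: F_inverse')
  qed
  show ?thesis
  proof (rule transfers_step[OF assms, where y = ?y and v = v])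
    show "continuous_on {0..h} ?y"
      using d by (rule continuous_on_vector_derivative)
    show "F i 0 (x1 + drift i 0 ?b) = x1" by (simp add: F_0 drift_def)
    show "(?y has_vector_derivative (A i *v ?y t + ?b)) (at t)" if "t \<in> {0<..<h}" for t
      using d[of t] that by (simp add: at_within_Icc_at)
  qed
qed

text \<open>
  States reachable from \<open>0\<close> with constant inputs along a list of pairs (mode, duration), whose head
  is the last step.
\<close>

fun reach :: "(nat \<times> real) list \<Rightarrow> (real^'n) set" where
  "reach [] = {0}"
| "reach ((i, h) # s) =
    F i h ` {p + q | p q. p \<in> reach s \<and> q \<in> drift i h ` range (inp_vec m B i)}"

fun free_motion :: "(nat \<times> real) list \<Rightarrow> real^'n \<Rightarrow> real^'n" where
  "free_motion [] x = x"
| "free_motion ((i, h) # s) x = F i h (free_motion s x)"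

definition schedule :: "(nat \<times> real) list \<Rightarrow> bool" where
  "schedule s \<longleftrightarrow> (\<forall>(i, h) \<in> set s. i \<in> {1..N} \<and> 0 < h)"

lemma schedule_simps [simp]:
  "schedule []" "schedule ((i, h) # s) \<longleftrightarrow> i \<in> {1..N} \<and> 0 < h \<and> schedule s"
  by (auto simp: schedule_def)

lemma schedule_append [simp]: "schedule (s @ t) \<longleftrightarrow> schedule s \<and> schedule t"
  by (auto simp: schedule_def)

lemma subspace_range_inp_vec: "subspace (range (inp_vec m B i))"
proof (rule subspaceI)
  show "0 \<in> range (inp_vec m B i)"
    by (rule range_eqI[of _ _ "\<lambda>_. 0"]) (simp add: inp_vec_def vec_eq_iff)
  show "x + y \<in> range (inp_vec m B i)" if "x \<in> range (inp_vec m B i)" "y \<in> range (inp_vec m B i)" for x y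
  proof -
    from that obtain v w where "x = inp_vec m B i v" "y = inp_vec m B i w" by blast
    then have "x + y = inp_vec m B i (\<lambda>k. v k + w k)"
      by (simp add: inp_vec_def vec_eq_iff sum.distrib algebra_simps)
    then show ?thesis by blast
  qed
  show "c *\<^sub>R x \<in> range (inp_vec m B i)" if "x \<in> range (inp_vec m B i)" for c x
  proof -
    from that obtain v where "x = inp_vec m B i v" by blast
    then have "c *\<^sub>R x = inp_vec m B i (\<lambda>k. c * v k)"
      by (simp add: inp_vec_def vec_eq_iff sum_distrib_left algebra_simps)
    then show ?thesis by blast
  qed
qed

lemma subspace_reach: "subspace (reach s)"
proof (induction s rule: reach.induct)
  case 1
  then show ?case by (simp add: subspace_0)
next
  case (2 i h s)
  then show ?case
    by (simp only: reach.simps)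
      (intro linear_subspace_image linear_F subspace_sums linear_drift subspace_range_inp_vec)
qed

lemma image_reach_subset: "F i h ` reach s \<subseteq> reach ((i, h) # s)"
proof -
  have "0 \<in> drift i h ` range (inp_vec m B i)"
    by (rule subspace_0) (intro linear_subspace_image linear_drift subspace_range_inp_vec)
  then show ?thesis
    by simp (force intro!: image_mono)
qed

lemma dim_image_F: "dim (F i h ` V) = dim V"
  by (rule dim_image_eq[OF linear_F]) (blast intro: inj_on_subset[OF inj_F])

text \<open>Each flow is injective and maps the old reachable subspace into the new one. Lists grow
  at the front, so \<open>s\<close> is the earlier part of the schedule.\<close>

lemma dim_reach_append: "dim (reach s) \<le> dim (reach (t @ s))"
proof (induction t)
  case (Cons p t)
  obtain i h where p: "p = (i, h)" by (cases p)
  have "dim (reach (t @ s)) = dim (F i h ` reach (t @ s))"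
    by (simp add: dim_image_F)
  also have "\<dots> \<le> dim (reach ((i, h) # t @ s))"
    by (rule dim_subset[OF image_reach_subset])
  finally show ?case using Cons p by simp
qed simp

text \<open>Superposition: the free motion of \<open>x\<close> and a response from \<open>0\<close>
  add up, by linearity of the flows.\<close>

lemma transfers_reach:
  assumes "schedule s" "r \<in> reach s"
  shows "transfers N m A B x (free_motion s x + r)"
  using assms
proof (induction s arbitrary: r rule: reach.induct)
  case 1
  then show ?case by (simp add: transfers_refl)
next
  case (2 i h s)
  then obtain p v where p: "p \<in> reach s" and r: "r = F i h (p + drift i h (inp_vec m B i v))"
    by auto
  have "transfers N m A B x (F i h ((free_motion s x + p) + drift i h (inp_vec m B i v)))"
    using 2 p by (intro transfers_drift) auto
  then show ?case
    by (simp add: r linear_add[OF linear_F] add.assoc)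
qed

text \<open>It suffices that one schedule reaches every state from \<open>0\<close>, since its
  inputs can then cancel the free motion of any initial state.\<close>

lemma controllable_if_no_proper_invariant_subspace:
  assumes full: "\<And>W. subspace W \<Longrightarrow> (\<And>i x. i \<in> {1..N} \<Longrightarrow> x \<in> W \<Longrightarrow> A i *v x \<in> W) \<Longrightarrow>
      (\<And>i v. i \<in> {1..N} \<Longrightarrow> inp_vec m B i v \<in> W) \<Longrightarrow> W = UNIV"
  shows "switched_controllable N m A B"
proof -
  have "\<exists>s. schedule s \<and> (\<forall>t. schedule t \<longrightarrow> dim (reach t) \<le> dim (reach s))"
    by (rule Lattices_Big.ex_has_greatest_nat[of schedule "[]" _ "Suc DIM(real^'n)"])
      (use dim_subset_UNIV[where 'a = "real^'n"] in \<open>auto simp: less_Suc_eq_le\<close>)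
  then obtain s where s: "schedule s" and max: "\<And>t. schedule t \<Longrightarrow> dim (reach t) \<le> dim (reach s)"
    by blast
  \<comment> \<open>One inclusion always holds. Flows preserve dimension and \<open>t @ s\<close>
    already has the maximal dimension, so the inclusion is an equality.\<close>
  have step: "reach ((i, h) # t @ s) = F i h ` reach (t @ s)"
    if "schedule t" "i \<in> {1..N}" "0 < h" for i h t
  proof -
    have "dim (reach ((i, h) # t @ s)) \<le> dim (F i h ` reach (t @ s))"
      using max[of "(i, h) # t @ s"] that s dim_reach_append[of s t] by (simp add: dim_image_F)
    then show ?thesis
      using subspace_dim_equal[OF _ subspace_reach image_reach_subset]
        linear_subspace_image[OF linear_F subspace_reach] by metis
  qed
  \<comment> \<open>Maximality makes all \<open>reach (t @ s)\<close> images of each other, so their intersection is invariant.\<close>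
  define W where "W = (\<Inter>t\<in>Collect schedule. reach (t @ s))"
  have "W = UNIV"
  proof (rule full)
    show W: "subspace W"
      unfolding W_def by (auto intro!: subspace_Inter simp: subspace_reach)
    \<comment> \<open>An element of \<open>W\<close> lies in the space of
      \<open>(i, h) # t @ s\<close>, which is the \<open>F i h\<close>-image of that of
      \<open>t @ s\<close>; undoing the flow leads back there. Differentiation at
      \<open>h = 0\<close> then gives invariance under \<open>A i\<close>.\<close>
    have backward: "F i (- h) x \<in> W" if "i \<in> {1..N}" "0 < h" "x \<in> W" for i h x
      unfolding W_def
    proof safe
      fix t assume t: "schedule t"
      then have "x \<in> reach (((i, h) # t) @ s)"
        using that unfolding W_def by (auto simp del: append_Cons)
      then have "x \<in> F i h ` reach (t @ s)"
        using step[OF t that(1,2)] by simp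
      then show "F i (- h) x \<in> reach (t @ s)"
        by (auto simp: F_inverse)
    qed
    show "A i *v x \<in> W" if "i \<in> {1..N}" "x \<in> W" for i x
    proof -
      have "- (A i *v F i (- 0) x) \<in> W"
        by (rule subspace_contains_derivative_at_right[OF W
              has_vector_derivative_at_within[OF F_back_derivative]])
          (use backward that W in \<open>auto simp: F_0 intro: subspace_diff\<close>)
      then show ?thesis using W by (auto simp: F_0 dest: subspace_neg)
    qed
    show "inp_vec m B i v \<in> W" if "i \<in> {1..N}" for i v
    proof -
      let ?b = "inp_vec m B i v"
      \<comment> \<open>Starting the new step from \<open>0\<close> shows that the flowed drift is
        reachable, and injectivity of the flow removes the flow. The derivative of the drift at
        \<open>0\<close> is the input vector itself.\<close>
      have "drift i h ?b \<in> W" if h: "0 < h" for h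
        unfolding W_def
      proof safe
        fix t assume t: "schedule t"
        have "0 \<in> reach (t @ s)" using subspace_0[OF subspace_reach] .
        then have "0 + drift i h ?b \<in> {p + q | p q. p \<in> reach (t @ s) \<and> q \<in> drift i h ` range (inp_vec m B i)}"
          by blast
        then have "F i h (0 + drift i h ?b) \<in> reach ((i, h) # t @ s)"
          by (simp only: reach.simps) (rule imageI)
        then have "F i h (drift i h ?b) \<in> F i h ` reach (t @ s)"
          using step[OF t \<open>i \<in> {1..N}\<close> h] by simp
        then show "drift i h ?b \<in> reach (t @ s)"
          by (auto dest: injD[OF inj_F])
      qed
      moreover have "drift i 0 ?b = 0" by (simp add: drift_def)
      ultimately have "F i (- 0) ?b \<in> W"
        by (intro subspace_contains_derivative_at_right[OF W drift_derivative]) auto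
      then show ?thesis by (simp add: F_0)
    qed
  qed
  moreover have "W \<subseteq> reach s"
  proof -
    have "[] \<in> Collect schedule" by simp
    then show ?thesis unfolding W_def by (metis INT_lower append_Nil)
  qed
  ultimately have "- free_motion s x \<in> reach s" for x by blast
  then have "transfers N m A B x (free_motion s x + - free_motion s x)" for x
    by (rule transfers_reach[OF s])
  then show ?thesis
    by (simp add: switched_controllable_def controllable_state_iff_transfers)
qed

end

lemma switched_controllable_if_no_proper_invariant_subspace:
  fixes A :: "nat \<Rightarrow> real^'n^'n" and B :: "nat \<Rightarrow> 'n::finite \<Rightarrow> nat \<Rightarrow> real"
  assumes "\<And>W. subspace W \<Longrightarrow> (\<And>i x. i \<in> {1..N} \<Longrightarrow> x \<in> W \<Longrightarrow> A i *v x \<in> W) \<Longrightarrow>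
      (\<And>i v. i \<in> {1..N} \<Longrightarrow> inp_vec m B i v \<in> W) \<Longrightarrow> W = UNIV"
  shows "switched_controllable N m A B"
proof -
  have "\<exists>F. is_flow ((*v) (A i)) F" for i
    by (rule linear_flow_exists) simp
  then obtain F where "\<And>i. is_flow ((*v) (A i)) (F i)"
    by metis
  then interpret switched_flow N m A B F
    by unfold_locales
  show ?thesis
    using assms by (rule controllable_if_no_proper_invariant_subspace)
qed

subsection \<open>Annihilating polynomials\<close>

abbreviation clinear :: "(complex^'n \<Rightarrow> complex^'n) \<Rightarrow> bool" where
  "clinear \<equiv> Vector_Spaces.linear (*s) (*s)"

definition cpoly_apply :: "(complex^'n \<Rightarrow> complex^'n) \<Rightarrow> complex poly \<Rightarrow> complex^'n \<Rightarrow> complex^'n" where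
  "cpoly_apply f p z = (\<Sum>i\<le>degree p. coeff p i *s (f ^^ i) z)"

lemma cpoly_apply_bound:
  assumes "degree p \<le> d"
  shows "cpoly_apply f p z = (\<Sum>i\<le>d. coeff p i *s (f ^^ i) z)"
  unfolding cpoly_apply_def
  by (rule sum.mono_neutral_left) (use assms in \<open>auto simp: coeff_eq_0 not_le\<close>)

lemma cpoly_apply_linear_factor:
  assumes "clinear f"
  shows "cpoly_apply f ([:- r, 1:] * p) z = f (cpoly_apply f p z) - r *s cpoly_apply f p z"
proof -
  let ?d = "degree p"
  have "degree ([:- r, 1:] * p) \<le> Suc ?d"
    by (rule order_trans[OF degree_mult_le]) simp
  then have "cpoly_apply f ([:- r, 1:] * p) z = (\<Sum>i\<le>Suc ?d. coeff ([:- r, 1:] * p) i *s (f ^^ i) z)"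
    by (rule cpoly_apply_bound)
  also have "\<dots> = (\<Sum>i\<le>Suc ?d. coeff (pCons 0 p) i *s (f ^^ i) z) - (\<Sum>i\<le>Suc ?d. (r * coeff p i) *s (f ^^ i) z)"
    by (simp add: sum_subtractf[symmetric] vec.scale_left_diff_distrib del: sum.atMost_Suc)
  also have "(\<Sum>i\<le>Suc ?d. coeff (pCons 0 p) i *s (f ^^ i) z) = (\<Sum>i\<le>?d. coeff p i *s f ((f ^^ i) z))"
    by (subst sum.atMost_Suc_shift) simp
  also have "\<dots> = f (cpoly_apply f p z)"
    by (simp add: cpoly_apply_def vec.linear_sum[OF assms] vec.linear_scale[OF assms])
  also have "(\<Sum>i\<le>Suc ?d. (r * coeff p i) *s (f ^^ i) z) = r *s cpoly_apply f p z"
    using cpoly_apply_bound[of p "Suc ?d" f z]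
    by (simp add: vec.scale_sum_right vector_smult_assoc del: sum.atMost_Suc)
  finally show ?thesis .
qed

text \<open>The product of the factors \<open>f - r i\<close> for \<open>i < d\<close>, applied to
  \<open>z\<close>. The recursion allows limits to be taken factor by factor while \<open>f\<close>,
  \<open>r\<close> and \<open>z\<close> all vary.\<close>

fun shifted_iter :: "(complex^'n \<Rightarrow> complex^'n) \<Rightarrow> (nat \<Rightarrow> complex) \<Rightarrow> nat \<Rightarrow> complex^'n \<Rightarrow> complex^'n" where
  "shifted_iter f r 0 z = z"
| "shifted_iter f r (Suc d) z = f (shifted_iter f r d z) - r d *s shifted_iter f r d z"

lemma cpoly_apply_prod_linear_factors:
  assumes "clinear f"
  shows "cpoly_apply f (\<Prod>i<d. [:- r i, 1:]) z = shifted_iter f r d z"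
proof (induction d)
  case 0
  then show ?case by (simp add: cpoly_apply_def)
next
  case (Suc d)
  then show ?case
    using cpoly_apply_linear_factor[OF assms, of "r d" "\<Prod>i<d. [:- r i, 1:]" z]
    by (simp add: mult.commute)
qed

text \<open>There is one more iterate than the dimension, so the iterates are dependent or two of
  them coincide. Coincidence is treated apart because dependence of a set does not see
  repetitions.\<close>

lemma annihilating_poly_exists:
  fixes f :: "complex^'n \<Rightarrow> complex^'n"
  shows "\<exists>p. p \<noteq> 0 \<and> degree p \<le> CARD('n) \<and> cpoly_apply f p z = 0"
proof (cases "inj_on (\<lambda>i. (f ^^ i) z) {..CARD('n)}")
  case True
  let ?S = "(\<lambda>i. (f ^^ i) z) ` {..CARD('n)}"
  have "card ?S = Suc CARD('n)"
    using True by (simp add: card_image)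
  moreover have "card ?S \<le> CARD('n)" if "vec.independent ?S"
    using vec.independent_card_le_dim[OF subset_UNIV that] unfolding vec_dim_card .
  ultimately have "vec.dependent ?S"
    by auto
  then obtain u v where v: "v \<in> ?S" "u v \<noteq> 0" and sum: "(\<Sum>v\<in>?S. u v *s v) = 0"
    by (auto simp: vec.dependent_finite)
  define p where "p = (\<Sum>i\<le>CARD('n). monom (u ((f ^^ i) z)) i)"
  have cf: "coeff p i = (if i \<le> CARD('n) then u ((f ^^ i) z) else 0)" for i
    by (auto simp: p_def coeff_sum if_distrib cong: if_cong)
  have deg: "degree p \<le> CARD('n)"
    by (rule degree_le) (simp add: cf)
  have "p \<noteq> 0"
    using v cf by (metis (no_types, lifting) atMost_iff coeff_0 imageE)
  moreover have "cpoly_apply f p z = 0"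
    using sum True by (simp add: cpoly_apply_bound[OF deg] cf sum.reindex)
  ultimately show ?thesis using deg by blast
next
  case False
  then obtain i j where ij: "i \<le> CARD('n)" "j \<le> CARD('n)" "i \<noteq> j" "(f ^^ i) z = (f ^^ j) z"
    by (auto simp: inj_on_def)
  define p :: "complex poly" where "p = monom 1 i - monom 1 j"
  have cf: "coeff p k = (if k = i then 1 else 0) - (if k = j then 1 else 0)" for k
    by (simp add: p_def)
  have deg: "degree p \<le> CARD('n)"
    by (rule degree_le) (use ij in \<open>auto simp: cf\<close>)
  have "p \<noteq> 0" using cf[of i] ij by auto
  moreover have "cpoly_apply f p z = 0"
    using ij by (simp add: cpoly_apply_bound[OF deg] cf vec.scale_left_diff_distrib sum_subtractf
        if_distrib[of "\<lambda>c. c *s _"] cong: if_cong)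
  ultimately show ?thesis using deg by blast
qed

text \<open>The shifts are the roots of the minimal annihilating polynomial of \<open>z\<close>, padded with zeros.\<close>

lemma annihilating_shifts_exist:
  fixes f :: "complex^'n \<Rightarrow> complex^'n"
  assumes f: "clinear f" and z: "z \<in> S" and S: "vec.subspace S" and fS: "\<And>x. x \<in> S \<Longrightarrow> f x \<in> S"
  shows "\<exists>r. shifted_iter f r CARD('n) z = 0 \<and>
    (\<forall>i. r i = 0 \<or> (\<exists>w\<in>S. w \<noteq> 0 \<and> f w = r i *s w))"
proof -
  let ?P = "\<lambda>p. p \<noteq> 0 \<and> cpoly_apply f p z = 0"
  obtain p0 where p0: "?P p0" "degree p0 \<le> CARD('n)"
    using annihilating_poly_exists by blast
  obtain p where p: "?P p" and pmin: "\<And>q. ?P q \<Longrightarrow> degree p \<le> degree q"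
    using ex_has_least_nat[of ?P p0 degree] p0 by blast
  have degp: "degree p \<le> CARD('n)"
    using pmin[OF p0(1)] p0(2) by simp
  obtain r0 where r0: "smult (lead_coeff p) (\<Prod>i<degree p. [:- r0 i, 1:]) = p"
    by (rule complex_poly_decompose')
  let ?d = "degree p"
  have powS: "(f ^^ i) z \<in> S" for i
    by (induction i) (auto simp: z fS)
  \<comment> \<open>Cancelling one linear factor of the minimal polynomial leaves \<open>q\<close>,
    which does not annihilate \<open>z\<close>. The vector it produces is killed by the cancelled
    factor, hence is an eigenvector.\<close>
  have eig: "\<exists>w\<in>S. w \<noteq> 0 \<and> f w = r0 i *s w" if "i < ?d" for i
  proof -
    define q where "q = smult (lead_coeff p) (\<Prod>i\<in>{..<?d} - {i}. [:- r0 i, 1:])"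
    have pq: "p = [:- r0 i, 1:] * q"
      by (subst r0[symmetric], subst prod.remove[of _ i]) (use that in \<open>auto simp: q_def mult_ac\<close>)
    then have "q \<noteq> 0" using p by auto
    then have "degree q < ?d"
      by (subst pq) (simp add: degree_mult_eq del: mult_pCons_left)
    then have nz: "cpoly_apply f q z \<noteq> 0"
      using pmin[of q] \<open>q \<noteq> 0\<close> by auto
    have "f (cpoly_apply f q z) - r0 i *s cpoly_apply f q z = 0"
      using p pq cpoly_apply_linear_factor[OF f, of "r0 i" q z] by simp
    moreover have "cpoly_apply f q z \<in> S"
      unfolding cpoly_apply_def by (intro vec.subspace_sum[OF S] vec.subspace_scale[OF S] powS)
    ultimately show ?thesis using nz by auto
  qed
  have smult: "cpoly_apply f (smult c q) z = c *s cpoly_apply f q z" for c q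
    by (subst cpoly_apply_bound[OF degree_smult_le])
      (simp add: cpoly_apply_def vec.scale_sum_right vector_smult_assoc)
  have "lead_coeff p *s shifted_iter f r0 ?d z = 0"
    by (simp add: p r0 flip: smult cpoly_apply_prod_linear_factors[OF f])
  then have zero: "shifted_iter f r0 ?d z = 0"
    using p by simp
  \<comment> \<open>Padding fixes the number of factors at \<open>CARD('n)\<close> for all
    \<open>z\<close> and \<open>f\<close>; after the iterate has become zero, further factors keep
    it zero.\<close>
  define r where "r i = (if i < ?d then r0 i else 0)" for i
  have "shifted_iter f r d z = shifted_iter f r0 d z" if "d \<le> ?d" for d
    using that by (induction d) (auto simp: r_def)
  then have "shifted_iter f r ?d z = 0" using zero by simp
  then have "shifted_iter f r (?d + k) z = 0" for k
    by (induction k) (auto simp: vec.linear_0[OF f])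
  from this[of "CARD('n) - ?d"] have "shifted_iter f r CARD('n) z = 0"
    using degp by simp
  moreover have "r i = 0 \<or> (\<exists>w\<in>S. w \<noteq> 0 \<and> f w = r i *s w)" for i
    using eig[of i] by (cases "i < ?d") (auto simp: r_def)
  ultimately show ?thesis by blast
qed

subsection \<open>Levels and rescaling\<close>

definition row_mult :: "complex^'n \<Rightarrow> real^'n^'n \<Rightarrow> complex^'n" where
  "row_mult z A = (\<chi> k. \<Sum>l\<in>UNIV. z $ l * of_real (A $ l $ k))"

text \<open>A bilinear form without conjugation, so that \<open>row_mult\<close> is the transpose of
  matrix-vector multiplication.\<close>

definition pairing :: "complex^'n \<Rightarrow> real^'n \<Rightarrow> complex" where
  "pairing z w = (\<Sum>l\<in>UNIV. z $ l * of_real (w $ l))"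

lemma clinear_row_mult: "clinear (\<lambda>z. row_mult z A)"
  unfolding Vector_Spaces.linear_iff
proof (intro conjI allI vec.vector_space_axioms)
  show "row_mult (x + y) A = row_mult x A + row_mult y A" for x y
    by (simp add: row_mult_def vec_eq_iff sum.distrib algebra_simps)
  show "row_mult (c *s x) A = c *s row_mult x A" for c x
    by (simp add: row_mult_def vec_eq_iff sum_distrib_left algebra_simps)
qed

lemma pairing_row_mult: "pairing (row_mult z A) w = pairing z (A *v w)"
proof -
  have "pairing (row_mult z A) w = (\<Sum>k\<in>UNIV. \<Sum>l\<in>UNIV. z $ l * of_real (A $ l $ k) * of_real (w $ k))"
    by (simp add: pairing_def row_mult_def sum_distrib_right)
  also have "\<dots> = pairing z (A *v w)"
    by (subst sum.swap) (simp add: pairing_def matrix_vector_mult_def sum_distrib_left mult.assoc)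
  finally show ?thesis .
qed

lemma tendsto_row_mult:
  assumes "(z \<longlongrightarrow> z0) F" and "\<And>l k. ((\<lambda>t. A t $ l $ k) \<longlongrightarrow> A0 $ l $ k) F"
  shows "((\<lambda>t. row_mult (z t) (A t)) \<longlongrightarrow> row_mult z0 A0) F"
  unfolding row_mult_def
  by (intro vec_tendstoI) (auto intro!: tendsto_intros assms)

lemma tendsto_vec_smult:
  fixes z :: "'b \<Rightarrow> complex^'n"
  assumes "(c \<longlongrightarrow> c0) F" "(z \<longlongrightarrow> z0) F"
  shows "((\<lambda>t. c t *s z t) \<longlongrightarrow> c0 *s z0) F"
  by (intro vec_tendstoI) (auto intro!: tendsto_intros assms)

text \<open>
  Level \<open>0\<close> consists of the states descending from inputs along \<open>par\<close>. A level \<open>r > 0\<close> consists of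
  the descendants, not yet on a lower level, of a single entry state \<open>l\<close>, which is attached to
  an input or to a lower level by the extra edge from \<open>q l\<close>. The rank \<open>dep\<close> is the distance from the
  entry (or input), so the only possible cycle of a level passes through its entry.
\<close>

locale leveled_parents =
  fixes par :: "'n::finite \<Rightarrow> 'n vert" and lev dep :: "'n \<Rightarrow> nat"
    and entry :: "'n \<Rightarrow> bool" and q :: "'n \<Rightarrow> 'n vert"
  assumes par_input: "par l = Inr u \<Longrightarrow> lev l = 0"
    and par_state: "par l = Inl k \<Longrightarrow> lev l \<le> lev k"
    and nonentry: "\<not> entry l \<Longrightarrow> par l = Inl k \<Longrightarrow> lev k = lev l \<and> dep k < dep l"
    and entry_pos: "entry l \<Longrightarrow> 0 < lev l"
    and entry_unique: "entry l \<Longrightarrow> entry l' \<Longrightarrow> lev l = lev l' \<Longrightarrow> l = l'"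
    and q_state: "entry l \<Longrightarrow> q l = Inl k \<Longrightarrow> lev k < lev l"
begin

text \<open>The weights are positive and differ between levels, so a given modulus singles out at
  most one level and hence at most one entry.\<close>

definition wt :: "'n \<Rightarrow> real" where
  "wt l = real (Suc (lev l))"

lemma wt_pos: "0 < wt l" by (simp add: wt_def)

lemma wt_cong: "lev k = lev l \<Longrightarrow> wt k = wt l" by (simp add: wt_def)

text \<open>This will be the sum of all modes of the realization. The exponents are made for
  conjugation by \<open>s ^ lev l\<close>, which gives extra edges the weight \<open>1\<close> and
  leaves nonnegative powers of \<open>s\<close> on parent edges.\<close>

definition sum_mat :: "real \<Rightarrow> real^'n^'n" where
  "sum_mat s = (\<chi> l k. (if par l = Inl k then wt l else 0) +
     (if entry l \<and> q l = Inl k then s ^ (lev l - lev k) else 0))"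

text \<open>Inputs count as level \<open>0\<close>, so the same rescaling absorbs every power of
  \<open>s\<close>.\<close>

definition sum_inp :: "real \<Rightarrow> real^'n" where
  "sum_inp s = (\<chi> l. (if \<exists>u. par l = Inr u then wt l else 0) +
     (if entry l \<and> (\<exists>u. q l = Inr u) then s ^ lev l else 0))"

text \<open>
  The conjugate of \<open>sum_mat s\<close> by the diagonal matrix with entries \<open>s ^ lev l\<close>. Its value at
  \<open>s = 0\<close> (where \<open>0 ^ 0 = 1\<close>) keeps the extra edges and drops the parent edges between different
  levels, so that every level carries at most one cycle, of spectral radius \<open>wt\<close>.
\<close>

definition scaled_mat :: "real \<Rightarrow> real^'n^'n" where
  "scaled_mat s = (\<chi> l k. (if par l = Inl k then wt l * s ^ (lev k - lev l) else 0) +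
     (if entry l \<and> q l = Inl k then 1 else 0))"

lemma scaled_mat_conj: "s ^ lev l * scaled_mat s $ l $ k = s ^ lev k * sum_mat s $ l $ k"
proof -
  have "s ^ lev l * s ^ (lev k - lev l) = s ^ lev k" if "par l = Inl k"
    using par_state[OF that] by (simp flip: power_add)
  moreover have "s ^ lev k * s ^ (lev l - lev k) = s ^ lev l" if "entry l" "q l = Inl k"
    using q_state[OF that] by (simp flip: power_add)
  ultimately show ?thesis
    by (auto simp: scaled_mat_def sum_mat_def algebra_simps)
qed

lemma sum_inp_scaled: "sum_inp s $ l = s ^ lev l * sum_inp 1 $ l"
  using par_input[of l] by (auto simp: sum_inp_def algebra_simps)

section \<open>Solving the forward equations of the rescaled limit\<close>

definition fwd :: "complex^'n \<Rightarrow> 'n \<Rightarrow> complex" where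
  "fwd y l = (\<Sum>k\<in>UNIV. of_real (scaled_mat 0 $ l $ k) * y $ k)"

lemma fwd_eq:
  "fwd y l = (case par l of Inl k \<Rightarrow> if lev k = lev l then of_real (wt l) * y $ k else 0 | Inr _ \<Rightarrow> 0) +
     (if entry l then (case q l of Inl k \<Rightarrow> y $ k | Inr _ \<Rightarrow> 0) else 0)"
proof -
  have "(\<Sum>k\<in>UNIV. of_real (if par l = Inl k then wt l * 0 ^ (lev k - lev l) else 0) * y $ k) =
      (case par l of Inl k \<Rightarrow> if lev k = lev l then of_real (wt l) * y $ k else 0 | Inr _ \<Rightarrow> 0)"
  proof (cases "par l")
    case (Inl j)
    have "(\<Sum>k\<in>UNIV. of_real (if par l = Inl k then wt l * 0 ^ (lev k - lev l) else 0) * y $ k) =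
        (\<Sum>k\<in>UNIV. if k = j then of_real (wt l * 0 ^ (lev j - lev l)) * y $ j else 0)"
      by (rule sum.cong) (auto simp: Inl)
    then show ?thesis
      \<comment> \<open>A parent never has a smaller level, so the truncated difference of levels is
        \<open>0\<close> exactly when they agree; only then does the power of \<open>0\<close> equal
        \<open>1\<close>.\<close>
      using par_state[OF Inl] by (auto simp: Inl power_0_left)
  qed simp
  moreover have "(\<Sum>k\<in>UNIV. of_real (if entry l \<and> q l = Inl k then 1 else 0) * y $ k) =
      (if entry l then (case q l of Inl k \<Rightarrow> y $ k | Inr _ \<Rightarrow> 0) else 0)"
  proof (cases "q l")
    case (Inl j)
    have "(\<Sum>k\<in>UNIV. of_real (if entry l \<and> q l = Inl k then 1 else 0) * y $ k) =
        (\<Sum>k\<in>UNIV. if k = j then (if entry l then y $ j else 0) else 0)"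
      by (rule sum.cong) (auto simp: Inl)
    then show ?thesis by (simp add: Inl)
  qed simp
  ultimately show ?thesis
    by (simp add: fwd_def scaled_mat_def sum.distrib distrib_right)
qed

lemma fwd_dual: "(\<Sum>l\<in>UNIV. z $ l * fwd y l) = (\<Sum>k\<in>UNIV. row_mult z (scaled_mat 0) $ k * y $ k)"
proof -
  have "(\<Sum>l\<in>UNIV. z $ l * fwd y l) =
      (\<Sum>l\<in>UNIV. \<Sum>k\<in>UNIV. z $ l * of_real (scaled_mat 0 $ l $ k) * y $ k)"
    by (simp add: fwd_def sum_distrib_left mult.assoc)
  also have "\<dots> = (\<Sum>k\<in>UNIV. row_mult z (scaled_mat 0) $ k * y $ k)"
    by (subst sum.swap) (simp add: row_mult_def sum_distrib_right)
  finally show ?thesis .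
qed

text \<open>Off the entry, the value at a state is \<open>wt / lam\<close> times the value at its
  parent on the same level. The rank decreases along parents, so the walk ends at the entry, or at a
  state fed by an input, where \<open>fwd\<close> and hence \<open>y\<close> vanish.\<close>

lemma transport_from_entry:
  assumes lam: "lam \<noteq> 0"
    and y: "\<And>l. lev l = r \<Longrightarrow> \<not> entry l \<Longrightarrow> lam * y $ l = fwd y l"
  shows "lev l = r \<Longrightarrow>
    y $ l = 0 \<or> (\<exists>d t. entry d \<and> lev d = r \<and> y $ l = (of_real (wt l) / lam) ^ t * y $ d)"
proof (induction "dep l" arbitrary: l rule: less_induct)
  case less
  show ?case
  proof (cases "entry l")
    case True
    then show ?thesis using less.prems by (intro disjI2 exI[of _ l] exI[of _ 0]) auto
  next
    case False
    show ?thesis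
    proof (cases "par l")
      case (Inl k)
      have k: "lev k = lev l" "dep k < dep l" using nonentry[OF False Inl] by auto
      have "lam * y $ l = of_real (wt l) * y $ k"
        using y[OF less.prems False] False k by (simp add: fwd_eq Inl)
      then have yl: "y $ l = (of_real (wt l) / lam) * y $ k"
        using lam by (simp add: field_simps)
      from less.hyps[OF k(2)] k less.prems
      consider "y $ k = 0" | d t where "entry d" "lev d = r" "y $ k = (of_real (wt l) / lam) ^ t * y $ d"
        by (auto simp: wt_cong[OF k(1)])
      then show ?thesis
      proof cases
        case 2
        then have "y $ l = (of_real (wt l) / lam) ^ Suc t * y $ d" by (simp add: yl)
        then show ?thesis using 2 by blast
      qed (simp add: yl)
    next
      case (Inr u)
      then show ?thesis using y[OF less.prems False] False lam by (simp add: fwd_eq)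
    qed
  qed
qed

text \<open>
  If the left eigenvector \<open>z\<close> of \<open>scaled_mat 0\<close> has eigenvalue \<open>lam \<noteq> 0\<close>, at most one entry \<open>d\<close>, whose
  level has weight \<open>norm lam\<close>, obstructs solving \<open>lam y - scaled_mat 0 y = g\<close>. Dropping the equation
  at \<open>d\<close> and pairing solutions with \<open>z\<close> gives first \<open>z d = 0\<close> and then \<open>z = 0\<close>.
\<close>

definition crit :: "complex \<Rightarrow> 'n set" where
  "crit lam = {d. entry d \<and> wt d = norm lam}"

text \<open>By induction on levels, nothing arrives from below, so a nonzero value at an entry must
  reproduce itself around the cycle of its level. This makes a power of \<open>wt d / lam\<close>
  equal to \<open>1\<close>, so the entry is critical, where \<open>y\<close> vanishes.\<close>

lemma fwd_injective_off_crit: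
  assumes lam: "lam \<noteq> 0"
    and y: "\<And>l. l \<notin> crit lam \<Longrightarrow> lam * y $ l = fwd y l"
    and y0: "\<And>l. l \<in> crit lam \<Longrightarrow> y $ l = 0"
  shows "y $ l = 0"
proof (induction "lev l" arbitrary: l rule: less_induct)
  case less
  let ?r = "lev l"
  have tr: "y $ k = 0 \<or> (\<exists>d t. entry d \<and> lev d = ?r \<and> y $ k = (of_real (wt k) / lam) ^ t * y $ d)"
    if "lev k = ?r" for k
    by (rule transport_from_entry[OF lam _ that]) (auto intro!: y simp: crit_def)
  have entries: "y $ d = 0" if d: "entry d" "lev d = ?r" for d
  proof (cases "d \<in> crit lam")
    case False
    have "(case q d of Inl k \<Rightarrow> y $ k | Inr _ \<Rightarrow> 0) = 0"
      using q_state[OF d(1)] less d(2) by (auto split: sum.splits)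
    then have eq: "lam * y $ d =
        (case par d of Inl k \<Rightarrow> if lev k = lev d then of_real (wt d) * y $ k else 0 | Inr _ \<Rightarrow> 0)"
      using y[OF False] d by (simp add: fwd_eq)
    show ?thesis
    proof (rule ccontr)
      assume nz: "y $ d \<noteq> 0"
      then obtain k where k: "par d = Inl k" "lev k = lev d" and e: "lam * y $ d = of_real (wt d) * y $ k"
        using eq lam by (auto split: sum.splits if_splits)
      then have "y $ k \<noteq> 0" using nz lam by auto
      then obtain d' t where d': "entry d'" "lev d' = ?r" and yk: "y $ k = (of_real (wt k) / lam) ^ t * y $ d'"
        using tr[of k] k d by auto
      then have "d' = d" using entry_unique d by simp
      then have "(of_real (wt d) * (of_real (wt d) / lam) ^ t - lam) * y $ d = 0"
        using e yk k by (auto simp: wt_cong[of k d] algebra_simps)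
      then have w: "of_real (wt d) * (of_real (wt d) / lam) ^ t = lam"
        using nz by simp
      have "(of_real (wt d) / lam) ^ Suc t = (of_real (wt d) * (of_real (wt d) / lam) ^ t) / lam"
        by simp
      also have "\<dots> = 1"
        unfolding w using lam by simp
      finally have "(of_real (wt d) / lam) ^ Suc t = 1" .
      then have "norm (of_real (wt d) / lam) = 1"
        using power_eq_1_iff nat.distinct(1) by blast
      then have "wt d = norm lam" using lam wt_pos[of d] by (simp add: norm_divide)
      then show False using False d by (simp add: crit_def)
    qed
  qed (use y0 in auto)
  show ?case using tr[OF refl] entries by (metis mult_zero_right)
qed

text \<open>Replacing the critical equations by \<open>y = 0\<close> there keeps the system square,
  so injectivity gives solvability.\<close>

lemma fwd_surjective_off_crit:
  assumes lam: "lam \<noteq> 0"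
  shows "\<exists>y. \<forall>l. if l \<in> crit lam then y $ l = 0 else lam * y $ l - fwd y l = g l"
proof -
  define L where "L y = (\<chi> l. if l \<in> crit lam then y $ l else lam * y $ l - fwd y l)" for y :: "complex^'n"
  have L: "clinear L"
    unfolding Vector_Spaces.linear_iff
  proof (intro conjI allI vec.vector_space_axioms)
    have "fwd (x + y) l = fwd x l + fwd y l" for x y l
      by (simp add: fwd_def sum.distrib algebra_simps)
    then show "L (x + y) = L x + L y" for x y
      by (simp add: L_def vec_eq_iff algebra_simps)
    have "fwd (c *s x) l = c * fwd x l" for c x l
      by (simp add: fwd_def sum_distrib_left algebra_simps)
    then show "L (c *s x) = c *s L x" for c x
      by (simp add: L_def vec_eq_iff algebra_simps)
  qed
  have "y = 0" if "L y = 0" for y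
  proof -
    have *: "(if l \<in> crit lam then y $ l else lam * y $ l - fwd y l) = 0" for l
      using that by (simp add: L_def vec_eq_iff)
    have "y $ l = 0" for l
    proof (rule fwd_injective_off_crit[OF lam])
      show "lam * y $ l = fwd y l" if "l \<notin> crit lam" for l using *[of l] that by simp
      show "y $ l = 0" if "l \<in> crit lam" for l using *[of l] that by simp
    qed
    then show ?thesis by (simp add: vec_eq_iff)
  qed
  then have "inj L" using vec.linear_inj_iff_eq_0[OF L] by blast
  then have "surj L" using vec.linear_injective_imp_surjective[OF L] by simp
  then have "L (inv L (\<chi> l. if l \<in> crit lam then 0 else g l)) = (\<chi> l. if l \<in> crit lam then 0 else g l)"
    by (rule surj_f_inv_f)
  then obtain y where "L y = (\<chi> l. if l \<in> crit lam then 0 else g l)" ..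
  then have *: "(if l \<in> crit lam then y $ l else lam * y $ l - fwd y l) = (if l \<in> crit lam then 0 else g l)" for l
    by (simp add: L_def vec_eq_iff)
  show ?thesis
    by (rule exI[of _ y]) (use * in presburger)
qed

text \<open>If the entry is at rest, so is its whole level. Nothing returns around the cycle, and
  the entry is fed by its extra edge alone.\<close>

lemma source_at_resting_entry:
  assumes lam: "lam \<noteq> 0" and k: "entry k" and yk: "y $ k = 0"
    and y: "\<And>j. lev j = lev k \<Longrightarrow> \<not> entry j \<Longrightarrow> lam * y $ j - fwd y j = of_real (sum_inp 1 $ j)"
  shows "fwd y k + of_real (sum_inp 1 $ k) = (case q k of Inl j \<Rightarrow> y $ j | Inr _ \<Rightarrow> 1)"
proof -
  have tr: "y $ j = 0 \<or> (\<exists>d t. entry d \<and> lev d = lev k \<and> y $ j = (of_real (wt j) / lam) ^ t * y $ d)"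
    if "lev j = lev k" for j
  proof (rule transport_from_entry[OF lam _ that])
    fix j assume j: "lev j = lev k" "\<not> entry j"
    then have "sum_inp 1 $ j = 0"
      using entry_pos[OF k] par_input[of j] by (auto simp: sum_inp_def)
    then show "lam * y $ j = fwd y j" using y[OF j] by simp
  qed
  have "y $ j = 0" if "lev j = lev k" for j
    using tr[OF that] entry_unique[OF k] yk by (metis mult_zero_right)
  then have "(case par k of Inl j \<Rightarrow> if lev j = lev k then of_real (wt k) * y $ j else 0 | Inr _ \<Rightarrow> 0) = 0"
    by (auto split: sum.splits)
  then have "fwd y k = (case q k of Inl j \<Rightarrow> y $ j | Inr _ \<Rightarrow> 0)"
    using k by (simp add: fwd_eq)
  moreover have "sum_inp 1 $ k = (if \<exists>u. q k = Inr u then 1 else 0)"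
    using k entry_pos[OF k] par_input[of k] by (auto simp: sum_inp_def)
  ultimately show ?thesis
    by (cases "q k") auto
qed

text \<open>Levels below that of \<open>d\<close> have other weights and so contain no critical
  entry. By induction on levels, the input signal arrives at every entry over its extra edge, or at
  level \<open>0\<close> from an input parent, and is passed on along parents with nonzero
  factors.\<close>

lemma response_nonzero_below_crit:
  assumes lam: "lam \<noteq> 0" and d: "wt d = norm lam"
    and y: "\<And>l. l \<notin> crit lam \<Longrightarrow> lam * y $ l - fwd y l = of_real (sum_inp 1 $ l)"
  shows "lev l < lev d \<Longrightarrow> y $ l \<noteq> 0"
proof (induction "lev l" arbitrary: l rule: less_induct)
  case less
  let ?r = "lev l"
  have nc: "k \<notin> crit lam" if "lev k = ?r" for k
    using that less.prems d by (auto simp: crit_def wt_def)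
  have entries: "y $ k \<noteq> 0" if k: "entry k" "lev k = ?r" for k
  proof
    assume yk: "y $ k = 0"
    have "fwd y k + of_real (sum_inp 1 $ k) = (case q k of Inl j \<Rightarrow> y $ j | Inr _ \<Rightarrow> 1)"
      by (rule source_at_resting_entry[OF lam k(1) yk]) (use nc y k in auto)
    moreover have "fwd y k + of_real (sum_inp 1 $ k) = 0"
      using y[OF nc[OF k(2)]] yk by (metis add.right_inverse diff_0 mult_zero_right)
    ultimately obtain j where "q k = Inl j" "y $ j = 0"
      by (cases "q k") auto
    then show False using less q_state[OF k(1)] k(2) by fastforce
  qed
  have "y $ k \<noteq> 0" if "lev k = ?r" for k
    using that
  proof (induction "dep k" arbitrary: k rule: less_induct)
    case (less k)
    note eq = y[OF nc[OF less.prems]]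
    show ?case
    proof (cases "entry k")
      case False
      show ?thesis
      proof (cases "par k")
        case (Inl j)
        have j: "lev j = lev k" "dep j < dep k" using nonentry[OF False Inl] by auto
        have "lam * y $ k = of_real (wt k) * y $ j"
          using eq False j by (simp add: fwd_eq Inl sum_inp_def)
        moreover have "y $ j \<noteq> 0" using less j by simp
        ultimately show ?thesis using wt_pos[of k] by auto
      next
        case (Inr u)
        then show ?thesis using eq False wt_pos[of k] by (auto simp: fwd_eq sum_inp_def)
      qed
    qed (use entries less in auto)
  qed
  then show ?case by blast
qed

lemma scaled_mat_nonzero_modes_controllable:
  assumes ev: "row_mult z (scaled_mat 0) = lam *s z" and lam: "lam \<noteq> 0"
    and inp: "pairing z (sum_inp 1) = 0"
  shows "z = 0"
proof -
  have dual: "(\<Sum>l\<in>UNIV. z $ l * (lam * y $ l - fwd y l)) = 0" for y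
  proof -
    have "(\<Sum>l\<in>UNIV. z $ l * fwd y l) = (\<Sum>l\<in>UNIV. lam * z $ l * y $ l)"
      by (simp add: fwd_dual ev)
    then show ?thesis by (simp add: right_diff_distrib sum_subtractf mult_ac)
  qed
  have zc: "z $ d = 0" if d: "d \<in> crit lam" for d
  proof -
    have dr: "entry d" "wt d = norm lam" using d by (auto simp: crit_def)
    \<comment> \<open>Here \<open>y\<close> is the response to the inputs, with the equation at the
      critical entry \<open>d\<close> given up. Pairing with \<open>z\<close> leaves only the defect
      at \<open>d\<close>, which is the nonzero signal arriving over the extra edge.\<close>
    obtain y where Y: "\<forall>l. if l \<in> crit lam then y $ l = 0 else lam * y $ l - fwd y l = of_real (sum_inp 1 $ l)"
      using fwd_surjective_off_crit[OF lam] ..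
    have y0: "y $ l = 0" if "l \<in> crit lam" for l
      using Y that by presburger
    have y: "lam * y $ l - fwd y l = of_real (sum_inp 1 $ l)" if "l \<notin> crit lam" for l
      using Y that by presburger
    have one: "l = d" if "l \<in> crit lam" for l
      using that dr entry_unique[of l d] by (auto simp: crit_def wt_def)
    have "0 = (\<Sum>l\<in>UNIV. z $ l * (lam * y $ l - fwd y l)) - pairing z (sum_inp 1)"
      by (simp add: dual inp)
    also have "\<dots> = (\<Sum>l\<in>UNIV. z $ l * (lam * y $ l - fwd y l - of_real (sum_inp 1 $ l)))"
      by (simp add: pairing_def algebra_simps sum_subtractf sum.distrib)
    also have "\<dots> = (\<Sum>l\<in>UNIV. if l = d then z $ d * (lam * y $ d - fwd y d - of_real (sum_inp 1 $ d)) else 0)"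
      by (rule sum.cong) (use y one in auto)
    also have "\<dots> = - z $ d * (fwd y d + of_real (sum_inp 1 $ d))"
      using y0[OF d] by (simp add: algebra_simps)
    finally have zero: "z $ d * (fwd y d + of_real (sum_inp 1 $ d)) = 0" by simp
    have "fwd y d + of_real (sum_inp 1 $ d) = (case q d of Inl j \<Rightarrow> y $ j | Inr _ \<Rightarrow> 1)"
      by (rule source_at_resting_entry[OF lam dr(1) y0[OF d]]) (auto intro!: y simp: crit_def)
    also have "\<dots> \<noteq> 0"
      using response_nonzero_below_crit[OF lam dr(2) y] q_state[OF dr(1)] by (auto split: sum.splits)
    finally show ?thesis using zero by simp
  qed
  have "z $ j = 0" if j: "j \<notin> crit lam" for j
  proof -
    \<comment> \<open>Since \<open>z\<close> vanishes on critical entries, the response to a point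
      source at \<open>j\<close> reads off \<open>z $ j\<close>.\<close>
    obtain y where Y: "\<forall>l. if l \<in> crit lam then y $ l = 0 else lam * y $ l - fwd y l = (if l = j then 1 else 0)"
      using fwd_surjective_off_crit[OF lam] ..
    have y: "lam * y $ l - fwd y l = (if l = j then 1 else 0)" if "l \<notin> crit lam" for l
      using Y that by presburger
    have "0 = (\<Sum>l\<in>UNIV. z $ l * (lam * y $ l - fwd y l))" by (simp add: dual)
    also have "\<dots> = (\<Sum>l\<in>UNIV. if l = j then z $ j else 0)"
    proof (rule sum.cong)
      fix l show "z $ l * (lam * y $ l - fwd y l) = (if l = j then z $ j else 0)"
        by (cases "l \<in> crit lam") (use y[of l] zc[of l] j in auto)
    qed simp
    finally show ?thesis by simp
  qed
  then show ?thesis using zc by (auto simp: vec_eq_iff)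
qed

section \<open>Uncontrollable eigenvalues as \<open>s\<close> tends to \<open>0\<close>\<close>

lemma tendsto_scaled_mat:
  assumes "(s \<longlongrightarrow> 0) F"
  shows "((\<lambda>t. scaled_mat (s t) $ l $ k) \<longlongrightarrow> scaled_mat 0 $ l $ k) F"
  unfolding scaled_mat_def by (auto intro!: tendsto_eq_intros assms)

text \<open>
  Otherwise the rescaled and normalized eigenvectors would accumulate at an uncontrollable nonzero
  mode of \<open>scaled_mat 0\<close>.
\<close>

lemma uncontrollable_eigenvalues_small:
  assumes c: "0 < c" and s: "s \<longlonglongrightarrow> 0" "\<And>k. 0 < s k"
  shows "\<forall>\<^sub>F k in sequentially. \<forall>z lam. z \<noteq> 0 \<longrightarrow> row_mult z (sum_mat (s k)) = lam *s z \<longrightarrow>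
    pairing z (sum_inp (s k)) = 0 \<longrightarrow> norm lam < c"
proof (rule ccontr)
  let ?bad = "\<lambda>k z lam. z \<noteq> 0 \<and> row_mult z (sum_mat (s k)) = lam *s z \<and>
    pairing z (sum_inp (s k)) = 0 \<and> c \<le> norm lam"
  assume "\<not> ?thesis"
  then have "\<exists>\<^sub>F k in sequentially. \<exists>z lam. ?bad k z lam"
    unfolding frequently_def
    by (rule contrapos_nn, elim eventually_mono) (meson not_le)
  then have "infinite {k. \<exists>z lam. ?bad k z lam}"
    unfolding cofinite_eq_sequentially[symmetric] frequently_cofinite .
  from infinite_enumerate[OF this] obtain r0 :: "nat \<Rightarrow> nat"
    where r0: "strict_mono r0" and "\<forall>k. r0 k \<in> {k. \<exists>z lam. ?bad k z lam}"
    by (elim exE conjE)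
  then have "\<forall>k. \<exists>z lam. ?bad (r0 k) z lam" by auto
  from choice[OF this] obtain z0 where "\<forall>k. \<exists>lam. ?bad (r0 k) (z0 k) lam" ..
  from choice[OF this] obtain lam where bad: "\<And>k. ?bad (r0 k) (z0 k) (lam k)" by blast
  \<comment> \<open>Rescaling turns a left eigenvector of \<open>sum_mat\<close> into one of
    \<open>scaled_mat\<close> with the same eigenvalue. Normalization comes afterwards, because the
    rescaled vectors may tend to \<open>0\<close>.\<close>
  define v where "v k = (\<chi> l. of_real (s (r0 k) ^ lev l) * z0 k $ l)" for k
  define z where "z k = of_real (inverse (norm (v k))) *s v k" for k
  have vnz: "v k \<noteq> 0" for k
  proof -
    obtain l where "z0 k $ l \<noteq> 0" using bad[of k] by (auto simp: vec_eq_iff)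
    then have "v k $ l \<noteq> 0" using s(2)[of "r0 k"] by (simp add: v_def)
    then show ?thesis by auto
  qed
  have smult_norm: "of_real a *s w = a *\<^sub>R w" for a and w :: "complex^'n"
    by (simp add: vec_eq_iff scaleR_conv_of_real[where 'a = complex])
  have znorm: "norm (z k) = 1" for k
    unfolding z_def smult_norm using vnz[of k] by simp
  have vev: "row_mult (v k) (scaled_mat (s (r0 k))) = lam k *s v k" for k
  proof -
    let ?s = "s (r0 k)"
    have "row_mult (v k) (scaled_mat ?s) $ j = lam k * v k $ j" for j
    proof -
      have "row_mult (v k) (scaled_mat ?s) $ j = (\<Sum>l\<in>UNIV. z0 k $ l * of_real (?s ^ lev l * scaled_mat ?s $ l $ j))"
        by (simp add: row_mult_def v_def mult_ac)
      also have "\<dots> = (\<Sum>l\<in>UNIV. z0 k $ l * of_real (?s ^ lev j * sum_mat ?s $ l $ j))"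
        by (simp only: scaled_mat_conj)
      also have "\<dots> = of_real (?s ^ lev j) * row_mult (z0 k) (sum_mat ?s) $ j"
        by (simp add: row_mult_def sum_distrib_left mult_ac)
      also have "\<dots> = lam k * v k $ j"
        using bad[of k] by (simp add: v_def mult_ac)
      finally show ?thesis .
    qed
    then show ?thesis by (simp add: vec_eq_iff)
  qed
  have zev: "row_mult (z k) (scaled_mat (s (r0 k))) = lam k *s z k" for k
    unfolding z_def vec.linear_scale[OF clinear_row_mult] vev
    by (simp add: vector_smult_assoc mult.commute)
  have zinp: "pairing (z k) (sum_inp 1) = 0" for k
  proof -
    have "pairing (v k) (sum_inp 1) = pairing (z0 k) (sum_inp (s (r0 k)))"
      unfolding pairing_def sum_inp_scaled[of "s (r0 k)"] by (simp add: v_def mult_ac)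
    moreover have "pairing (z k) (sum_inp 1) = of_real (inverse (norm (v k))) * pairing (v k) (sum_inp 1)"
      by (simp add: pairing_def z_def sum_distrib_left mult.assoc)
    ultimately show ?thesis using bad[of k] by simp
  qed
  have "compact (sphere (0::complex^'n) 1)" by simp
  moreover have "\<forall>k. z k \<in> sphere 0 1" by (simp add: znorm)
  ultimately have "\<exists>w\<in>sphere 0 1. \<exists>r. strict_mono r \<and> (z \<circ> r) \<longlonglongrightarrow> w"
    unfolding compact_def by (elim allE[of _ z]) (rule mp)
  then obtain w r where w: "w \<in> sphere 0 1" and r: "strict_mono r" and lim: "(z \<circ> r) \<longlonglongrightarrow> w"
    by (elim bexE exE conjE)
  have lim': "(\<lambda>k. z (r k)) \<longlonglongrightarrow> w" using lim by (simp add: o_def)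
  have slim: "(\<lambda>k. s (r0 (r k))) \<longlonglongrightarrow> 0"
    using LIMSEQ_subseq_LIMSEQ[OF s(1) strict_mono_o[OF r0 r]] by (simp add: o_def)
  have mlim: "(\<lambda>k. row_mult (z (r k)) (scaled_mat (s (r0 (r k))))) \<longlonglongrightarrow> row_mult w (scaled_mat 0)"
    by (intro tendsto_row_mult lim' tendsto_scaled_mat slim)
  have "w \<noteq> 0" using w by auto
  then obtain l where l: "w $ l \<noteq> 0" by (auto simp: vec_eq_iff)
  \<comment> \<open>No bound on the eigenvalues is at hand; their convergence is read off at a
    coordinate where the limit vector is nonzero.\<close>
  define lam0 where "lam0 = row_mult w (scaled_mat 0) $ l / w $ l"
  have "(\<lambda>k. row_mult (z (r k)) (scaled_mat (s (r0 (r k)))) $ l / z (r k) $ l) \<longlonglongrightarrow> lam0"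
    unfolding lam0_def by (intro tendsto_divide tendsto_vec_nth mlim lim' l)
  moreover have "\<forall>\<^sub>F k in sequentially. z (r k) $ l \<noteq> 0"
    using tendsto_imp_eventually_ne[OF tendsto_vec_nth[OF lim'] l] .
  then have "\<forall>\<^sub>F k in sequentially. row_mult (z (r k)) (scaled_mat (s (r0 (r k)))) $ l / z (r k) $ l = lam (r k)"
    by eventually_elim (simp add: zev)
  ultimately have lamlim: "(\<lambda>k. lam (r k)) \<longlonglongrightarrow> lam0"
    by (rule Lim_transform_eventually)
  have "c \<le> norm lam0"
    by (rule tendsto_lowerbound[OF tendsto_norm[OF lamlim]]) (use bad in auto)
  then have nz: "lam0 \<noteq> 0" using c by auto
   have ev0: "row_mult w (scaled_mat 0) = lam0 *s w"
    using LIMSEQ_unique[OF mlim[unfolded zev] tendsto_vec_smult[OF lamlim lim']] .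
  have "pairing w (sum_inp 1) = 0"
  proof -
    have "(\<lambda>k. pairing (z (r k)) (sum_inp 1)) \<longlonglongrightarrow> pairing w (sum_inp 1)"
      unfolding pairing_def by (intro tendsto_intros lim')
    then show ?thesis by (simp add: zinp LIMSEQ_const_iff)
  qed
  from scaled_mat_nonzero_modes_controllable[OF ev0 nz this] show False
    using \<open>w \<noteq> 0\<close> by contradiction
qed

end

subsection \<open>Perturbed parent realizations\<close>

text \<open>The functionals are complex so that eigenvectors can be found among them.\<close>

definition annihilator :: "(real^'n) set \<Rightarrow> (complex^'n) set" where
  "annihilator W = {z. \<forall>w\<in>W. pairing z w = 0}"

lemma subspace_annihilator: "vec.subspace (annihilator W)"
  unfolding vec.subspace_def annihilator_def pairing_def
  by (auto simp: distrib_right sum.distrib mult.assoc simp flip: sum_distrib_left)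

lemma row_mult_annihilator:
  "(\<And>w. w \<in> W \<Longrightarrow> A *v w \<in> W) \<Longrightarrow> z \<in> annihilator W \<Longrightarrow> row_mult z A \<in> annihilator W"
  by (simp add: annihilator_def pairing_row_mult)

lemma unit_annihilator_exists:
  fixes W :: "(real^'n) set"
  assumes "subspace W" "W \<noteq> UNIV"
  shows "\<exists>z\<in>annihilator W. norm z = 1"
proof -
  have "span W \<noteq> UNIV" using assms by (simp add: span_eq_iff[THEN iffD2])
  from span_not_UNIV_orthogonal[OF this] obtain a where a: "a \<noteq> 0" "\<And>x. x \<in> W \<Longrightarrow> a \<bullet> x = 0"
    by (auto intro: span_base)
  define c :: "complex^'n" where "c = (\<chi> l. of_real (a $ l))"
  have "c \<noteq> 0" using a(1) by (auto simp: c_def vec_eq_iff)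
  have c: "pairing c w = of_real (a \<bullet> w)" for w
    by (simp add: pairing_def c_def inner_vec_def)
  have "pairing (inverse (norm c) *\<^sub>R c) w = inverse (norm c) *\<^sub>R pairing c w" for w
    by (simp add: pairing_def scaleR_sum_right)
  then have "inverse (norm c) *\<^sub>R c \<in> annihilator W"
    using a(2) c by (simp add: annihilator_def)
  moreover have "norm (inverse (norm c) *\<^sub>R c) = 1" using \<open>c \<noteq> 0\<close> by simp
  ultimately show ?thesis by blast
qed

text \<open>The assumption \<open>par_inj\<close> is what disjointness of the covering provides:
  tail and color determine the child, so at \<open>s = 0\<close> no single mode merges two
  coordinate functionals.\<close>

locale colored_leveled_parents = leveled_parents par lev dep entry q
  for par :: "'n::finite \<Rightarrow> 'n vert" and lev dep entry q +
  fixes N :: nat and m :: "nat \<Rightarrow> nat" and col qc :: "'n \<Rightarrow> nat"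
  assumes col: "col l \<in> {1..N}"
    and par_input_col: "par l = Inr (i, h) \<Longrightarrow> col l = i \<and> h < m i"
    and par_inj: "par l = par l' \<Longrightarrow> col l = col l' \<Longrightarrow> l = l'"
    and qc: "entry l \<Longrightarrow> qc l \<in> {1..N}"
    and q_input: "entry l \<Longrightarrow> q l = Inr (i, h) \<Longrightarrow> i \<in> {1..N} \<and> h < m i"
begin

definition mode_mat :: "real \<Rightarrow> nat \<Rightarrow> real^'n^'n" where
  "mode_mat s i = (\<chi> l k. (if par l = Inl k \<and> col l = i then wt l else 0) +
     (if entry l \<and> q l = Inl k \<and> qc l = i then s ^ (lev l - lev k) else 0))"

definition mode_inp :: "real \<Rightarrow> nat \<Rightarrow> 'n \<Rightarrow> nat \<Rightarrow> real" where
  "mode_inp s i l h = (if par l = Inr (i, h) then wt l else 0) +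
     (if entry l \<and> q l = Inr (i, h) then s ^ lev l else 0)"

lemma sum_mode_mat: "(\<Sum>i\<in>{1..N}. mode_mat s i) = sum_mat s"
proof -
  have "(\<Sum>i\<in>{1..N}. if P \<and> c = i then x else 0) = (if P then x else (0::real))"
    if "P \<Longrightarrow> c \<in> {1..N}" for P c x
    using that by (cases P) auto
  then show ?thesis
    using col qc by (simp add: vec_eq_iff sum_mat_def mode_mat_def sum.distrib flip: conj_assoc)
qed

text \<open>With every input held at \<open>1\<close>, the sum of all input columns is seen to lie
  in each subspace that contains the images of the input matrices.\<close>

lemma sum_mode_inp: "(\<Sum>i\<in>{1..N}. inp_vec m (mode_inp s) i (\<lambda>_. 1)) = sum_inp s"
proof -
  have pick: "(\<Sum>i\<in>{1..N}. \<Sum>h<m i. if P \<and> v = Inr (i, h) then x else 0) =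
      (if P \<and> (\<exists>u. v = Inr u) then x else (0::real))"
    if v: "\<And>i h. P \<Longrightarrow> v = Inr (i, h) \<Longrightarrow> i \<in> {1..N} \<and> h < m i" for P x and v :: "'n vert"
  proof (cases "P \<and> (\<exists>u. v = Inr u)")
    case True
    then obtain i0 h0 where eq: "v = Inr (i0, h0)" and P by auto
    have "(\<Sum>i\<in>{1..N}. \<Sum>h<m i. if P \<and> v = Inr (i, h) then x else 0) =
        (\<Sum>i\<in>{1..N}. \<Sum>h<m i. if h = h0 then (if i = i0 then x else 0) else 0)"
      using \<open>P\<close> by (intro sum.cong) (auto simp: eq)
    also have "\<dots> = (\<Sum>i\<in>{1..N}. if i = i0 then x else 0)"
      by (intro sum.cong) (use v[OF \<open>P\<close> eq] in auto)
    also have "\<dots> = x" using v[OF \<open>P\<close> eq] by simp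
    finally show ?thesis using True by simp
  qed auto
  have "sum_inp s $ l = (\<Sum>i\<in>{1..N}. inp_vec m (mode_inp s) i (\<lambda>_. 1)) $ l" for l
  proof -
    have "i \<in> {1..N} \<and> h < m i" if "par l = Inr (i, h)" for i h
      using par_input_col[OF that] col[of l] by simp
    then have "(\<Sum>i\<in>{1..N}. \<Sum>h<m i. if par l = Inr (i, h) then wt l else 0) = (if \<exists>u. par l = Inr u then wt l else 0)"
      using pick[of True "par l" "wt l"] by simp
    moreover have "(\<Sum>i\<in>{1..N}. \<Sum>h<m i. if entry l \<and> q l = Inr (i, h) then s ^ lev l else 0) =
        (if entry l \<and> (\<exists>u. q l = Inr u) then s ^ lev l else 0)"
      by (rule pick) (rule q_input)
    ultimately show ?thesis
      by (simp add: sum_inp_def inp_vec_def mode_inp_def sum.distrib)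
  qed
  then show ?thesis by (simp add: vec_eq_iff)
qed

section \<open>The modes at \<open>s = 0\<close> and iterated parents\<close>

lemma mode_mat_0: "mode_mat 0 i $ l $ k = (if par l = Inl k \<and> col l = i then wt l else 0)"
  using q_state[of l k] by (auto simp: mode_mat_def)

lemma sum_mat_0: "sum_mat 0 $ l $ k = (if par l = Inl k then wt l else 0)"
  using q_state[of l k] by (auto simp: sum_mat_def)

lemma mode_inp_0: "mode_inp 0 i l h = (if par l = Inr (i, h) then wt l else 0)"
  using entry_pos[of l] by (auto simp: mode_inp_def)

text \<open>The image of the \<open>t\<close>-th iterate of the partial parent map; these sets
  shrink to the states on cycles of \<open>par\<close>.\<close>

definition depth_image :: "nat \<Rightarrow> 'n set" where
  "depth_image t = Range ({(l, k). par l = Inl k} ^^ t)"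

lemma depth_image_Suc: "depth_image (Suc t) = {k. \<exists>l\<in>depth_image t. par l = Inl k}"
  by (auto simp: depth_image_def relcomp_unfold)

lemma depth_image_antimono: "depth_image (Suc t) \<subseteq> depth_image t"
proof (induction t)
  case 0
  then show ?case by (auto simp: depth_image_def)
next
  case (Suc t)
  then show ?case by (subst (1 2) depth_image_Suc) blast
qed

lemma depth_image_stabilizes: "\<exists>t. depth_image (Suc t) = depth_image t"
proof -
  obtain t where t: "\<And>t'. card (depth_image t) \<le> card (depth_image t')"
    using ex_has_least_nat[of "\<lambda>_. True" 0 "\<lambda>t. card (depth_image t)"] by auto
  show ?thesis
    by (rule exI[of _ t], rule card_subset_eq) (auto simp: depth_image_antimono t le_antisym card_mono)
qed

text \<open>
  At \<open>s = 0\<close> every mode moves a coordinate functional to its parent, without collisions inside one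
  mode. A nonzero functional can thus be pushed back along parents until it is supported on
  the cycles of \<open>par\<close>, where even the sum of all modes acts injectively.
\<close>

lemma no_nilpotent_invariant_functionals:
  assumes z0: "z0 \<in> S" "z0 \<noteq> 0"
    and inv: "\<And>z i. z \<in> S \<Longrightarrow> i \<in> {1..N} \<Longrightarrow> row_mult z (mode_mat 0 i) \<in> S"
    and inp: "\<And>z i h. z \<in> S \<Longrightarrow> i \<in> {1..N} \<Longrightarrow> h < m i \<Longrightarrow> (\<Sum>l\<in>UNIV. z $ l * of_real (mode_inp 0 i l h)) = 0"
    and nil: "\<And>z. z \<in> S \<Longrightarrow> ((\<lambda>z. row_mult z (sum_mat 0)) ^^ d) z = 0"
  shows False
proof -
  have push: "\<exists>z\<in>S. z \<noteq> 0 \<and> (\<forall>l. z $ l \<noteq> 0 \<longrightarrow> l \<in> depth_image t)" for t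
  proof (induction t)
    case 0
    then show ?case using z0 by (auto simp: depth_image_def)
  next
    case (Suc t)
    then obtain z where z: "z \<in> S" "z \<noteq> 0" "\<And>l. z $ l \<noteq> 0 \<Longrightarrow> l \<in> depth_image t" by blast
    from z(2) obtain j where j: "z $ j \<noteq> 0" by (auto simp: vec_eq_iff)
    show ?case
    proof (cases "par j")
      case (Inl k)
      \<comment> \<open>In the mode of color \<open>col j\<close> no other state has parent
        \<open>k\<close>, so the coordinate at \<open>k\<close> comes from \<open>j\<close> alone
        and cannot cancel.\<close>
      define z' where "z' = row_mult z (mode_mat 0 (col j))"
      have "z' \<in> S" unfolding z'_def using inv z(1) col by blast
      moreover have "z' $ k = z $ j * of_real (wt j)"
      proof -
        have "z' $ k = (\<Sum>l\<in>UNIV. if l = j then z $ j * of_real (wt j) else 0)"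
          unfolding z'_def row_mult_def vec_lambda_beta mode_mat_0
          by (rule sum.cong) (use par_inj Inl in auto)
        then show ?thesis by simp
      qed
      then have "z' \<noteq> 0" using j wt_pos[of j] by auto
      moreover have "l \<in> depth_image (Suc t)" if "z' $ l \<noteq> 0" for l
      proof (rule ccontr)
        assume "l \<notin> depth_image (Suc t)"
        then have "z $ i * of_real (mode_mat 0 (col j) $ i $ l) = 0" for i
          using z(3)[of i] by (auto simp: depth_image_Suc mode_mat_0)
        then have "z' $ l = 0"
          unfolding z'_def row_mult_def vec_lambda_beta by (intro sum.neutral) blast
        then show False using that by contradiction
      qed
      ultimately show ?thesis by blast
    next
      case (Inr u)
      obtain i h where u: "u = (i, h)" by (cases u)
      have par_j: "par j = Inr (i, h)" by (simp add: Inr u)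
      \<comment> \<open>The column of this input has its only nonzero entry at \<open>j\<close>; a
        functional killing the column must vanish at \<open>j\<close>, contrary to the choice of
        \<open>j\<close>.\<close>
      have "l = j" if "par l = Inr (i, h)" for l
        using par_inj[of l j] par_input_col[OF that] par_input_col[OF par_j] that par_j by simp
      then have "mode_inp 0 i l h = (if l = j then wt j else 0)" for l
        using par_j unfolding mode_inp_0 by metis
      then have "(\<Sum>l\<in>UNIV. z $ l * of_real (mode_inp 0 i l h)) =
          (\<Sum>l\<in>UNIV. if l = j then z $ j * of_real (wt j) else 0)"
        by (intro sum.cong) auto
      then have "z $ j * of_real (wt j) = 0"
        using inp[OF z(1), of i h] par_input_col[OF par_j] col[of j] by simp
      then show ?thesis using j wt_pos[of j] by simp
    qed
  qed
  obtain t where t: "depth_image (Suc t) = depth_image t" using depth_image_stabilizes by blast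
  define G where "G = depth_image t"
  \<comment> \<open>At the stable stage \<open>G\<close> is the image of its subset
    \<open>G'\<close> under \<open>g\<close>. Counting gives \<open>G' = G\<close>, so the parent
    map permutes \<open>G\<close> and the dummy value of \<open>g\<close> does not occur
    there.\<close>
  define g where "g l = (case par l of Inl k \<Rightarrow> k | Inr _ \<Rightarrow> l)" for l
  define G' where "G' = {l \<in> G. \<exists>k. par l = Inl k}"
  have GG: "G = g ` G'"
    using t by (auto simp: G_def G'_def g_def depth_image_Suc image_iff) force+
  have "card G \<le> card G'" unfolding GG by (rule card_image_le) simp
  then have "G' = G" by (intro card_subset_eq) (auto simp: G'_def card_mono intro!: le_antisym)
  then have inj: "inj_on g G" using GG by (intro eq_card_imp_inj_on) auto
  have parG: "par l = Inl (g l)" "g l \<in> G" if "l \<in> G" for l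
  proof -
    have l: "l \<in> G'" using that unfolding \<open>G' = G\<close> .
    then show "par l = Inl (g l)" by (auto simp: G'_def g_def)
    show "g l \<in> G" using imageI[OF l, of g] unfolding GG[symmetric] .
  qed
  have step: "row_mult z (sum_mat 0) \<noteq> 0 \<and> (\<forall>l. row_mult z (sum_mat 0) $ l \<noteq> 0 \<longrightarrow> l \<in> G)"
    if z: "z \<noteq> 0" "\<forall>l. z $ l \<noteq> 0 \<longrightarrow> l \<in> G" for z
  proof
    obtain j where j: "z $ j \<noteq> 0" using z(1) by (auto simp: vec_eq_iff)
    then have jG: "j \<in> G" using z(2) by blast
    have "row_mult z (sum_mat 0) $ g j = (\<Sum>l\<in>UNIV. if l = j then z $ j * of_real (wt j) else 0)"
      unfolding row_mult_def vec_lambda_beta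
    proof (rule sum.cong)
      fix l show "z $ l * of_real (sum_mat 0 $ l $ g j) = (if l = j then z $ j * of_real (wt j) else 0)"
      proof (cases "z $ l = 0")
        case False
        then have "l \<in> G" using z(2) by blast
        then show ?thesis
          using parG(1)[of l] inj_onD[OF inj, of l j] jG by (auto simp: sum_mat_0)
      qed (use j in auto)
    qed simp
    then show "row_mult z (sum_mat 0) \<noteq> 0" using j wt_pos[of j] by auto
    show "\<forall>l. row_mult z (sum_mat 0) $ l \<noteq> 0 \<longrightarrow> l \<in> G"
    proof (intro allI impI, rule ccontr)
      fix l assume l: "row_mult z (sum_mat 0) $ l \<noteq> 0" "l \<notin> G"
      then have "z $ i * of_real (sum_mat 0 $ i $ l) = 0" for i
        using z(2) parG[of i] by (auto simp: sum_mat_0)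
      then have "row_mult z (sum_mat 0) $ l = 0"
        unfolding row_mult_def vec_lambda_beta by (intro sum.neutral) blast
      then show False using l(1) by contradiction
    qed
  qed
  obtain z where z: "z \<in> S" "z \<noteq> 0" "\<forall>l. z $ l \<noteq> 0 \<longrightarrow> l \<in> G" using push[of t] G_def by blast
  have "((\<lambda>z. row_mult z (sum_mat 0)) ^^ e) z \<noteq> 0 \<and>
      (\<forall>l. ((\<lambda>z. row_mult z (sum_mat 0)) ^^ e) z $ l \<noteq> 0 \<longrightarrow> l \<in> G)" for e
    by (induction e) (use z step in auto)
  then show False using nil[OF z(1)] by blast
qed

section \<open>Passage to the limit\<close>

definition uncontrollable_subspace :: "real \<Rightarrow> (real^'n) set \<Rightarrow> bool" where
  "uncontrollable_subspace s W \<longleftrightarrow> subspace W \<and> W \<noteq> UNIV \<and>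
    (\<forall>i\<in>{1..N}. \<forall>x\<in>W. mode_mat s i *v x \<in> W) \<and> (\<forall>i\<in>{1..N}. \<forall>v. inp_vec m (mode_inp s) i v \<in> W)"

lemma controllable_parameter_exists: "\<exists>s>0. \<forall>W. \<not> uncontrollable_subspace s W"
proof (rule ccontr)
  assume "\<not> ?thesis"
  then have "\<forall>s. \<exists>W. 0 < s \<longrightarrow> uncontrollable_subspace s W" by blast
  from choice[OF this] obtain W where W: "\<And>s. 0 < s \<Longrightarrow> uncontrollable_subspace s (W s)" by blast
  define s0 :: "nat \<Rightarrow> real" where "s0 k = inverse (real (Suc k))" for k
  have s0: "0 < s0 k" "s0 \<longlonglongrightarrow> 0" for k
    unfolding s0_def using LIMSEQ_inverse_real_of_nat by auto
  have "\<forall>k. \<exists>z\<in>annihilator (W (s0 k)). norm z = 1"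
    using W[OF s0(1)] unit_annihilator_exists unfolding uncontrollable_subspace_def by blast
  then obtain c where c: "\<And>k. c k \<in> annihilator (W (s0 k))" "\<And>k. norm (c k) = 1" by metis
  have "compact (sphere (0::complex^'n) 1)" by simp
  moreover have "\<forall>k. c k \<in> sphere 0 1" by (simp add: c)
  ultimately have "\<exists>w\<in>sphere 0 1. \<exists>r. strict_mono r \<and> (c \<circ> r) \<longlonglongrightarrow> w"
    unfolding compact_def by (elim allE[of _ c]) (rule mp)
  then obtain w r where w: "w \<in> sphere 0 1" and r: "strict_mono r" and lim: "(c \<circ> r) \<longlonglongrightarrow> w"
    by (elim bexE exE conjE)
  define s where "s = s0 \<circ> r"
  have s: "0 < s k" "s \<longlonglongrightarrow> 0" for k
    unfolding s_def using s0(1) LIMSEQ_subseq_LIMSEQ[OF s0(2) r] by auto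
  note Ws = W[OF s(1), unfolded uncontrollable_subspace_def]
  \<comment> \<open>All limits are taken along one subsequence on which some unit functionals
    converge; this makes \<open>S\<close> nonzero, while invariance and annihilation of inputs pass
    to the limit by continuity.\<close>
  define S where "S = {z. \<exists>zs. (\<forall>k. zs k \<in> annihilator (W (s k))) \<and> zs \<longlonglongrightarrow> z}"
  show False
  proof (rule no_nilpotent_invariant_functionals)
    show "w \<in> S"
      unfolding S_def s_def using lim c by (auto intro!: exI[of _ "c \<circ> r"])
    show "w \<noteq> 0" using w by auto
    show "row_mult z (mode_mat 0 i) \<in> S" if z: "z \<in> S" and i: "i \<in> {1..N}" for z i
    proof -
      obtain zs where zs: "\<And>k. zs k \<in> annihilator (W (s k))" "zs \<longlonglongrightarrow> z" using z by (auto simp: S_def)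
      have "(\<lambda>k. row_mult (zs k) (mode_mat (s k) i)) \<longlonglongrightarrow> row_mult z (mode_mat 0 i)"
        by (rule tendsto_row_mult[OF zs(2)]) (auto simp: mode_mat_def intro!: tendsto_eq_intros s)
      moreover have "row_mult (zs k) (mode_mat (s k) i) \<in> annihilator (W (s k))" for k
        using row_mult_annihilator[OF _ zs(1)] Ws i by blast
      ultimately show ?thesis unfolding S_def by (auto intro!: exI[of _ "\<lambda>k. row_mult (zs k) (mode_mat (s k) i)"])
    qed
    show "(\<Sum>l\<in>UNIV. z $ l * of_real (mode_inp 0 i l h)) = 0"
      if z: "z \<in> S" and i: "i \<in> {1..N}" and h: "h < m i" for z i h
    proof -
      obtain zs where zs: "\<And>k. zs k \<in> annihilator (W (s k))" "zs \<longlonglongrightarrow> z" using z by (auto simp: S_def)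
      have "(\<lambda>k. \<Sum>l\<in>UNIV. zs k $ l * of_real (mode_inp (s k) i l h)) \<longlonglongrightarrow>
          (\<Sum>l\<in>UNIV. z $ l * of_real (mode_inp 0 i l h))"
        unfolding mode_inp_def by (auto intro!: tendsto_eq_intros tendsto_vec_nth zs s)
      moreover have "(\<Sum>l\<in>UNIV. zs k $ l * of_real (mode_inp (s k) i l h)) = 0" for k
      proof -
        let ?v = "\<lambda>h'. if h' = h then 1 else 0"
        have "inp_vec m (mode_inp (s k)) i ?v = (\<chi> l. mode_inp (s k) i l h)"
          using h by (simp add: inp_vec_def vec_eq_iff if_distrib cong: if_cong)
        moreover have "inp_vec m (mode_inp (s k)) i ?v \<in> W (s k)" using Ws i by blast
        ultimately have "pairing (zs k) (\<chi> l. mode_inp (s k) i l h) = 0"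
          using zs(1)[of k] by (simp add: annihilator_def)
        then show ?thesis by (simp add: pairing_def)
      qed
      ultimately show ?thesis by (simp add: LIMSEQ_const_iff)
    qed
    show "((\<lambda>z. row_mult z (sum_mat 0)) ^^ CARD('n)) z = 0" if z: "z \<in> S" for z
    proof -
      obtain zs where zs: "\<And>k. zs k \<in> annihilator (W (s k))" "zs \<longlonglongrightarrow> z" using z by (auto simp: S_def)
      let ?f = "\<lambda>k z. row_mult z (sum_mat (s k))"
      have inv: "sum_mat (s k) *v x \<in> W (s k)" if "x \<in> W (s k)" for k x
      proof -
        have "sum_mat (s k) *v x = (\<Sum>i\<in>{1..N}. mode_mat (s k) i *v x)"
          unfolding sum_mode_mat[symmetric]
          by (induction N) (auto simp: matrix_vector_mult_add_rdistrib)
        also have "\<dots> \<in> W (s k)"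
          using Ws[of k] that by (intro subspace_sum) blast+
        finally show ?thesis .
      qed
      have inp: "sum_inp (s k) \<in> W (s k)" for k
        unfolding sum_mode_inp[symmetric] using Ws[of k] by (intro subspace_sum) blast+
      \<comment> \<open>Every shift is zero or an eigenvalue on a functional that kills the inputs,
        so the shifts tend to \<open>0\<close>. In the limit the vanishing product of
        \<open>CARD('n)\<close> factors becomes a pure power of \<open>sum_mat 0\<close>.\<close>
      have "\<forall>k. \<exists>\<rho>. shifted_iter (?f k) \<rho> CARD('n) (zs k) = 0 \<and>
          (\<forall>i. \<rho> i = 0 \<or> (\<exists>w\<in>annihilator (W (s k)). w \<noteq> 0 \<and> ?f k w = \<rho> i *s w))"
        by (intro allI annihilating_shifts_exist[OF clinear_row_mult zs(1) subspace_annihilator])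
          (blast intro: row_mult_annihilator inv)
      from choice[OF this] obtain \<rho> where \<rho>0: "\<And>k. shifted_iter (?f k) (\<rho> k) CARD('n) (zs k) = 0"
        and \<rho>: "\<And>k i. \<rho> k i = 0 \<or> (\<exists>w\<in>annihilator (W (s k)). w \<noteq> 0 \<and> ?f k w = \<rho> k i *s w)"
        by blast
      have \<rho>lim: "(\<lambda>k. \<rho> k i) \<longlonglongrightarrow> 0" for i
      proof (rule tendstoI)
        fix e :: real assume e: "0 < e"
        from uncontrollable_eigenvalues_small[OF this s(2,1)]
        show "\<forall>\<^sub>F k in sequentially. dist (\<rho> k i) 0 < e"
        proof eventually_elim
          case (elim k)
          from \<rho>[of k i] show ?case
          proof
            assume "\<exists>w\<in>annihilator (W (s k)). w \<noteq> 0 \<and> ?f k w = \<rho> k i *s w"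
            then obtain w where "w \<in> annihilator (W (s k))" "w \<noteq> 0" "?f k w = \<rho> k i *s w" by blast
            moreover from this have "pairing w (sum_inp (s k)) = 0"
              using inp[of k] by (simp add: annihilator_def)
            ultimately show ?thesis using elim by simp
          qed (use e in simp)
        qed
      qed
      have "(\<lambda>k. shifted_iter (?f k) (\<rho> k) d (zs k)) \<longlonglongrightarrow> ((\<lambda>z. row_mult z (sum_mat 0)) ^^ d) z" for d
      proof (induction d)
        case 0
        then show ?case using zs by simp
      next
        case (Suc d)
        have "(\<lambda>k. row_mult (shifted_iter (?f k) (\<rho> k) d (zs k)) (sum_mat (s k))) \<longlonglongrightarrow>
            row_mult (((\<lambda>z. row_mult z (sum_mat 0)) ^^ d) z) (sum_mat 0)"
          by (rule tendsto_row_mult[OF Suc]) (auto simp: sum_mat_def intro!: tendsto_eq_intros s)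
        from tendsto_diff[OF this tendsto_vec_smult[OF \<rho>lim[of d] Suc]] show ?case by simp
      qed
      from this[of "CARD('n)"] show ?thesis by (simp add: \<rho>0 LIMSEQ_const_iff)
    qed
  qed
qed

end

subsection \<open>Construction of the levels\<close>

text \<open>The set \<open>T\<close> of states leveled so far is closed under taking children, and
  \<open>M\<close> is the next free level. An entry may still have its parent outside
  \<open>T\<close>.\<close>

definition partial_leveling ::
  "('n::finite \<Rightarrow> 'n vert) \<Rightarrow> ('n vert \<times> 'n vert) set \<Rightarrow> 'n set \<Rightarrow> nat \<Rightarrow> ('n \<Rightarrow> nat) \<Rightarrow> ('n \<Rightarrow> nat)
    \<Rightarrow> ('n \<Rightarrow> bool) \<Rightarrow> ('n \<Rightarrow> 'n vert) \<Rightarrow> bool" where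
  "partial_leveling par R T M lev dep entry q \<longleftrightarrow>
    (\<forall>l u. par l = Inr u \<longrightarrow> l \<in> T \<and> lev l = 0) \<and>
    (\<forall>l k. par l = Inl k \<longrightarrow> k \<in> T \<longrightarrow> l \<in> T \<and> lev l \<le> lev k) \<and>
    (\<forall>l\<in>T. \<not> entry l \<longrightarrow> (\<forall>k. par l = Inl k \<longrightarrow> k \<in> T \<and> lev k = lev l \<and> dep k < dep l)) \<and>
    (\<forall>l\<in>T. entry l \<longrightarrow> 0 < lev l \<and> (q l, Inl l) \<in> R \<and> (\<forall>k. q l = Inl k \<longrightarrow> k \<in> T \<and> lev k < lev l)) \<and>
    (\<forall>l\<in>T. \<forall>l'\<in>T. entry l \<longrightarrow> entry l' \<longrightarrow> lev l = lev l' \<longrightarrow> l = l') \<and>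
    (\<forall>l\<in>T. lev l < M) \<and> 0 < M"

text \<open>A shortest path from \<open>d\<close> to \<open>l\<close> must arrive through the unique
  predecessor of \<open>l\<close>, so the distance drops there.\<close>

lemma least_relpow_pred:
  assumes "(d, l) \<in> C\<^sup>*" and "d \<noteq> l" and C: "\<And>k. (k, l) \<in> C \<Longrightarrow> k = k0"
  shows "(d, k0) \<in> C\<^sup>* \<and> (LEAST t. (d, k0) \<in> C ^^ t) < (LEAST t. (d, l) \<in> C ^^ t)"
proof -
  let ?t = "LEAST t. (d, l) \<in> C ^^ t"
  have "(d, l) \<in> C ^^ ?t"
    using assms(1) by (metis LeastI_ex rtrancl_imp_relpow)
  moreover from this have "?t \<noteq> 0" using assms(2) by (metis relpow_0_E)
  then obtain t' where t': "?t = Suc t'" by (metis not0_implies_Suc)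
  ultimately obtain k where "(d, k) \<in> C ^^ t'" "(k, l) \<in> C" by auto
  then have "(d, k0) \<in> C ^^ t'" using C by blast
  then show ?thesis
    using t' by (auto intro: relpow_imp_rtrancl Least_le le_imp_less_Suc)
qed

text \<open>Level \<open>0\<close> collects the descendants of states with an input parent; the rank
  is the distance from such a state.\<close>

lemma partial_leveling_initial:
  "\<exists>T lev dep entry q. partial_leveling par R T 1 lev dep entry q"
proof -
  define C where "C = {(k, l). par l = Inl k}"
  define T where "T = {l. \<exists>t k u. par k = Inr u \<and> (k, l) \<in> C ^^ t}"
  define dep where "dep l = (LEAST t. \<exists>k u. par k = Inr u \<and> (k, l) \<in> C ^^ t)" for l
  have A1: "k \<in> T \<and> dep k < dep l" if l: "l \<in> T" "par l = Inl k" for l k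
  proof -
    have "\<exists>t. \<exists>k u. par k = Inr u \<and> (k, l) \<in> C ^^ t" using l by (auto simp: T_def)
    from LeastI_ex[OF this] obtain k0 u where k0: "par k0 = Inr u" "(k0, l) \<in> C ^^ dep l"
      unfolding dep_def by blast
    then have "dep l \<noteq> 0" using l(2) by (metis relpow_0_E sum.distinct(1))
    then obtain t where t: "dep l = Suc t" by (metis not0_implies_Suc)
    then obtain k' where "(k0, k') \<in> C ^^ t" "(k', l) \<in> C" using k0 by auto
    then have *: "(k0, k) \<in> C ^^ t" using l(2) by (simp add: C_def)
    then have "dep k \<le> t" unfolding dep_def using k0 by (intro Least_le) blast
    moreover have "k \<in> T" unfolding T_def using * k0(1) by blast
    ultimately show ?thesis using t by simp
  qed
  have A2: "l \<in> T" if "par l = Inr u" for l u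
    using that unfolding T_def by (auto intro!: exI[of _ 0])
  have A3: "l \<in> T" if "k \<in> T" "par l = Inl k" for k l
  proof -
    from that obtain t k0 u where "par k0 = Inr u" "(k0, k) \<in> C ^^ t" "(k, l) \<in> C"
      by (auto simp: T_def C_def)
    then have "(k0, l) \<in> C ^^ Suc t" by auto
    then show ?thesis using \<open>par k0 = Inr u\<close> unfolding T_def by blast
  qed
  \<comment> \<open>Level \<open>0\<close> has no entries, so any \<open>q\<close> will do.\<close>
  have "partial_leveling par R T 1 (\<lambda>_. 0) dep (\<lambda>_. False) undefined"
    unfolding partial_leveling_def
    by (intro conjI allI ballI impI; (simp; fail | blast dest: A1 intro: A2 A3))
  then show ?thesis by blast
qed

text \<open>Input-reachability yields an edge into a state \<open>d\<close> outside \<open>T\<close>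
  whose tail is an input or lies in \<open>T\<close>. This edge is the extra edge of the entry
  \<open>d\<close>, and the descendants of \<open>d\<close> outside \<open>T\<close> form level
  \<open>M\<close>.\<close>

lemma partial_leveling_extend:
  assumes pl: "partial_leveling par R T M lev dep entry q" and T: "T \<noteq> UNIV"
    and reach: "\<And>l. \<exists>u. (Inr u, Inl l) \<in> R\<^sup>+"
  shows "\<exists>T' lev dep entry q. T \<subset> T' \<and> partial_leveling par R T' (Suc M) lev dep entry q"
proof -
  have "\<exists>v d. (v, Inl d) \<in> R \<and> d \<notin> T \<and> (\<forall>k. v = Inl k \<longrightarrow> k \<in> T)"
  proof (rule ccontr)
    assume no: "\<not> ?thesis"
    obtain l0 where "l0 \<notin> T" using T by blast
    obtain u where "(Inr u, Inl l0) \<in> R\<^sup>+" using reach by blast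
    then have "\<forall>k. Inl l0 = (Inl k :: 'a vert) \<longrightarrow> k \<in> T"
      by (induction rule: trancl_induct) (use no in blast)+
    then show False using \<open>l0 \<notin> T\<close> by simp
  qed
  then obtain v d where vd: "(v, Inl d) \<in> R" "d \<notin> T" "\<And>k. v = Inl k \<Longrightarrow> k \<in> T" by blast
  define C where "C = {(k, l). par l = Inl k}"
  define L where "L = {l. l \<notin> T \<and> (d, l) \<in> C\<^sup>*}"
  define lev' where "lev' l = (if l \<in> T then lev l else M)" for l
  define dep' where "dep' l = (if l \<in> T then dep l else (LEAST t. (d, l) \<in> C ^^ t))" for l
  define entry' where "entry' l = (if l \<in> T then entry l else l = d)" for l
  define q' where "q' = q(d := v)"
  note pl' = pl[unfolded partial_leveling_def]
  have dL: "d \<in> L" using vd by (simp add: L_def)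
  have "partial_leveling par R (T \<union> L) (Suc M) lev' dep' entry' q'"
    unfolding partial_leveling_def
  proof (intro conjI allI ballI impI)
    fix l u assume "par l = Inr u"
    then show "l \<in> T \<union> L" "lev' l = 0" using pl' by (auto simp: lev'_def)
  next
    fix l k assume lk: "par l = Inl k" and k: "k \<in> T \<union> L"
    have old: "l \<in> T \<and> lev l \<le> lev k" if "k \<in> T" using that lk pl' by blast
    have new: "l \<in> T \<union> L" if "k \<in> L"
    proof -
      have "(k, l) \<in> C" using lk by (simp add: C_def)
      then have "(d, l) \<in> C\<^sup>*" using that by (auto simp: L_def intro: rtrancl_into_rtrancl)
      then show ?thesis by (auto simp: L_def)
    qed
    show "l \<in> T \<union> L" using old new k by blast
    have "lev l \<le> M" if "l \<in> T" using that pl' less_imp_le by blast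
    then show "lev' l \<le> lev' k"
      using old k by (auto simp: lev'_def L_def)
  next
    fix l k assume l: "l \<in> T \<union> L" "\<not> entry' l" "par l = Inl k"
    have "k \<in> T \<union> L \<and> lev' k = lev' l \<and> dep' k < dep' l"
    proof (cases "l \<in> T")
      case True
      then have "\<not> entry l" using l by (simp add: entry'_def)
      then have "k \<in> T \<and> lev k = lev l \<and> dep k < dep l" using True l pl' by blast
      then show ?thesis using True by (simp add: lev'_def dep'_def)
    next
      case False
      then have "l \<noteq> d" "(d, l) \<in> C\<^sup>*" using l by (auto simp: entry'_def L_def)
      then have "(d, k) \<in> C\<^sup>* \<and> (LEAST t. (d, k) \<in> C ^^ t) < (LEAST t. (d, l) \<in> C ^^ t)"
        using l(3) by (intro least_relpow_pred) (auto simp: C_def)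
      moreover have "k \<notin> T" using False l pl' by blast
      ultimately show ?thesis using False by (simp add: lev'_def dep'_def L_def)
    qed
    then show "k \<in> T \<union> L" "lev' k = lev' l" "dep' k < dep' l" by auto
  next
    fix l assume l: "l \<in> T \<union> L" "entry' l"
    have *: "0 < lev' l \<and> (q' l, Inl l) \<in> R \<and> (\<forall>k. q' l = Inl k \<longrightarrow> k \<in> T \<and> lev' k < lev' l)"
    proof (cases "l \<in> T")
      case True
      then have "entry l" using l by (simp add: entry'_def)
      then have "0 < lev l \<and> (q l, Inl l) \<in> R \<and> (\<forall>k. q l = Inl k \<longrightarrow> k \<in> T \<and> lev k < lev l)"
        using True pl' by blast
      moreover have "l \<noteq> d" using True vd by blast
      ultimately show ?thesis using True by (simp add: lev'_def q'_def)
    next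
      case False
      then have "l = d" using l by (simp add: entry'_def)
      moreover have "k \<in> T \<and> lev k < M" if "v = Inl k" for k
        using vd(3)[OF that] pl' by blast
      moreover have "0 < M" using pl' by blast
      ultimately show ?thesis using vd(1,2) by (simp add: lev'_def q'_def)
    qed
    show "0 < lev' l" "(q' l, Inl l) \<in> R" using * by blast+
    show "k \<in> T \<union> L" "lev' k < lev' l" if "q' l = Inl k" for k
      using * that by blast+
  next
    fix l l' assume l: "l \<in> T \<union> L" "l' \<in> T \<union> L" "entry' l" "entry' l'" "lev' l = lev' l'"
    have M: "lev k \<noteq> M" if "k \<in> T" for k using that pl' by blast
    have old: "l = l'" if "l \<in> T" "l' \<in> T" "entry l" "entry l'" "lev l = lev l'"
      using that pl' by blast
    show "l = l'"
    proof (cases "l \<in> T"; cases "l' \<in> T")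
      assume "l \<in> T" "l' \<in> T"
      then show ?thesis using old l by (simp add: entry'_def lev'_def)
    next
      assume "l \<notin> T" "l' \<notin> T"
      then show ?thesis using l by (simp add: entry'_def)
    qed (use l M[of l] M[of l'] in \<open>simp_all add: lev'_def\<close>)
  next
    fix l assume "l \<in> T \<union> L"
    have "lev l < M" if "l \<in> T" using that pl' by blast
    then show "lev' l < Suc M" by (simp add: lev'_def less_SucI)
  qed simp
  then show ?thesis using dL vd(2) by blast
qed

lemma leveling_exists:
  fixes par :: "'n::finite \<Rightarrow> 'n vert"
  assumes reach: "\<And>l. \<exists>u. (Inr u, Inl l) \<in> R\<^sup>+"
  shows "\<exists>lev dep entry q. leveled_parents par lev dep entry q \<and> (\<forall>l. entry l \<longrightarrow> (q l, Inl l) \<in> R)"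
proof -
  have "\<exists>M lev dep entry q. partial_leveling par R UNIV M lev dep entry q"
    if "partial_leveling par R T M lev dep entry q" for T M lev dep entry q
    using that
  proof (induction "card (- T)" arbitrary: T M lev dep entry q rule: less_induct)
    case less
    show ?case
    proof (cases "T = UNIV")
      case False
      from partial_leveling_extend[OF less.prems False reach]
      obtain T' lev' dep' entry' q' where T': "T \<subset> T'"
        and pl: "partial_leveling par R T' (Suc M) lev' dep' entry' q'" by blast
      have "card (- T') < card (- T)" using T' by (intro psubset_card_mono) auto
      from less.hyps[OF this pl] show ?thesis .
    qed (use less.prems in blast)
  qed
  then obtain M lev dep entry q where pl: "partial_leveling par R UNIV M lev dep entry q"
    using partial_leveling_initial[of par R] by blast
  have "leveled_parents par lev dep entry q"
    by unfold_locales (use pl in \<open>simp_all add: partial_leveling_def\<close>)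
  moreover have "\<forall>l. entry l \<longrightarrow> (q l, Inl l) \<in> R"
    using pl by (simp add: partial_leveling_def)
  ultimately show ?thesis by blast
qed

subsection \<open>Generalized stems and buds\<close>

lemma periodic_point_exists:
  fixes f :: "'n::finite \<Rightarrow> 'n"
  assumes l: "l \<in> S" and f: "f ` S \<subseteq> S"
  shows "\<exists>k\<in>S. \<exists>p>0. (f ^^ p) k = k"
proof -
  have fS: "(f ^^ i) l \<in> S" for i
    by (induction i) (use l f in auto)
  have "\<not> inj (\<lambda>i. (f ^^ i) l)"
    using finite_imageD[of "\<lambda>i. (f ^^ i) l" UNIV] by auto
  then obtain i j where "i < j" "(f ^^ i) l = (f ^^ j) l"
    by (metis injI linorder_neqE_nat)
  then have "(f ^^ (j - i)) ((f ^^ i) l) = (f ^^ i) l"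
    by (metis add_diff_inverse_nat comp_apply funpow_add add.commute less_imp_le not_less)
  then show ?thesis using fS \<open>i < j\<close> by (metis zero_less_diff)
qed

text \<open>In a finite set, repeated passage to predecessors becomes periodic; an orbit of minimal
  period has distinct vertices and is a cycle.\<close>

lemma cycle_from_predecessors:
  fixes f :: "'n::finite \<Rightarrow> 'n" and ed :: "'n \<Rightarrow> 'n cedge"
  assumes l: "l \<in> S" and f: "f ` S \<subseteq> S"
    and ed: "\<And>k. k \<in> S \<Longrightarrow> ed k \<in> Es \<and> etail (ed k) = Inl (f k) \<and> ehead (ed k) = Inl k"
  shows "cycles Es \<noteq> {}"
proof -
  obtain k where k: "k \<in> S" "\<exists>p>0. (f ^^ p) k = k"
    using periodic_point_exists[OF l f] by (elim bexE)
  define p where "p = (LEAST p. 0 < p \<and> (f ^^ p) k = k)"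
  have p: "0 < p" "(f ^^ p) k = k"
    using LeastI_ex[OF k(2)] by (auto simp: p_def)
  have pmin: "(f ^^ i) k \<noteq> k" if "0 < i" "i < p" for i
    using not_less_Least[of i "\<lambda>p. 0 < p \<and> (f ^^ p) k = k"] that by (auto simp: p_def)
  have fS: "(f ^^ i) k \<in> S" for i
    by (induction i) (use k f in auto)
  \<comment> \<open>Since \<open>f\<close> runs against the edges, the orbit is listed backwards;
    \<open>(f ^^ p) k = k\<close> closes the walk.\<close>
  define es where "es = map (\<lambda>i. ed ((f ^^ (p - Suc i)) k)) [0..<p]"
  have len: "length es = p" by (simp add: es_def)
  have nth: "es ! i = ed ((f ^^ (p - Suc i)) k)" if "i < p" for i
    using that by (simp add: es_def)
  have tail: "etail (es ! i) = Inl ((f ^^ (p - i)) k)" if "i < p" for i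
  proof -
    have "(f ^^ (p - i)) k = f ((f ^^ (p - Suc i)) k)"
      by (metis Suc_diff_Suc[OF that] comp_apply funpow.simps(2))
    then show ?thesis using ed[OF fS] nth[OF that] by simp
  qed
  have head: "ehead (es ! i) = Inl ((f ^^ (p - Suc i)) k)" if "i < p" for i
    using that ed[OF fS] by (simp add: nth)
  have inj: "(f ^^ a) k \<noteq> (f ^^ b) k" if ab: "a < b" "0 < a" "b \<le> p" for a b
  proof
    assume "(f ^^ a) k = (f ^^ b) k"
    then have "(f ^^ (p - b)) ((f ^^ a) k) = (f ^^ (p - b)) ((f ^^ b) k)" by simp
    then have "(f ^^ (p - b + a)) k = (f ^^ (p - b + b)) k"
      by (simp add: funpow_add)
    then have "(f ^^ (p - b + a)) k = k" using ab p by simp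
    moreover have "(f ^^ (p - b + a)) k \<noteq> k"
      by (rule pmin) (use ab in auto)
    ultimately show False by contradiction
  qed
  have "is_cycle Es es"
    unfolding is_cycle_def
  proof (intro conjI allI impI)
    show "es \<noteq> []" using p len by auto
    show "set es \<subseteq> Es" using ed fS by (auto simp: es_def)
    show "ehead (es ! i) = etail (es ! (Suc i mod length es))" if "i < length es" for i
    proof (cases "Suc i = p")
      case True
      then have "Suc i mod length es = 0" by (simp add: len)
      then show ?thesis using that True tail[of 0] head[of i] p len by simp
    next
      case False
      then have "Suc i < p" using that len by simp
      then show ?thesis using tail[of "Suc i"] head[of i] len by simp
    qed
    show "distinct (map etail es)"
      unfolding distinct_conv_nth
    proof (intro allI impI)
      fix i j assume "i < length (map etail es)" "j < length (map etail es)" "i \<noteq> j"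
      then have ij: "i < p" "j < p" "i \<noteq> j" by (auto simp: len)
      then consider "p - i < p - j" | "p - j < p - i" by linarith
      then have "(f ^^ (p - i)) k \<noteq> (f ^^ (p - j)) k"
        by cases (use ij inj[of "p - i" "p - j"] inj[of "p - j" "p - i"] in auto)
      then show "map etail es ! i \<noteq> map etail es ! j"
        using ij by (simp add: len tail)
    qed
  qed
  then show ?thesis by (auto simp: cycles_def)
qed

section \<open>Input-reachability in stems\<close>

lemma Gc_edges_iff:
  "(Inl k, Inl j, i) \<in> Gc_edges N m SA SB \<longleftrightarrow> i \<in> {1..N} \<and> SA i j k"
  "(Inr (i', h), Inl j, i) \<in> Gc_edges N m SA SB \<longleftrightarrow> i' = i \<and> i \<in> {1..N} \<and> h < m i \<and> SB i j h"
  by (auto simp: Gc_edges_def)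

lemma Gc_edge_cases:
  assumes "e \<in> Gc_edges N m SA SB"
  obtains k j i where "e = (Inl k, Inl j, i)" "i \<in> {1..N}" "SA i j k"
  | k j i where "e = (Inr (i, k), Inl j, i)" "i \<in> {1..N}" "k < m i" "SB i j k"
  using assms unfolding Gc_edges_def by blast

lemma input_reachable_edge:
  assumes "(v, w, i) \<in> Gc_edges N m SA SB"
    and "v \<in> input_verts N m \<or> input_reachable N m SA SB v"
  shows "input_reachable N m SA SB w"
proof -
  let ?R = "{(etail e, ehead e) | e. e \<in> Gc_edges N m SA SB}"
  have "(v, w) \<in> ?R" using assms(1) by (force simp: etail_def ehead_def)
  then show ?thesis
    using assms(2) unfolding input_reachable_def by (meson r_into_trancl' trancl_into_trancl)
qed

text \<open>The ingoing edge of an unreachable state of the stem must start at another such state,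
  or at itself, so following these edges backwards would produce a cycle.\<close>

lemma gen_stem_input_reachable:
  fixes SA :: "nat \<Rightarrow> 'n::finite \<Rightarrow> 'n \<Rightarrow> bool"
  assumes st: "gen_stem N m SA SB Vs Es" and l: "Inl l \<in> Vs"
  shows "input_reachable N m SA SB (Inl l)"
proof (rule ccontr)
  assume not: "\<not> ?thesis"
  define S where "S = {k. Inl k \<in> Vs \<and> \<not> input_reachable N m SA SB (Inl k)}"
  have "\<exists>e k'. e \<in> Es \<and> etail e = Inl k' \<and> ehead e = Inl k \<and> k' \<in> S" if k: "k \<in> S" for k
  proof -
    have "Inl k \<in> Vs \<inter> state_verts" using k by (auto simp: S_def state_verts_def)
    then obtain e where e: "e \<in> Es" "ehead e = Inl k"
      using st unfolding gen_stem_def one_ingoing_def by blast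
    have G: "e \<in> Gc_edges N m SA SB" and tl: "etail e \<in> Vs"
      using st e unfolding gen_stem_def is_subgraph_def by auto
    from G show ?thesis
    proof (cases rule: Gc_edge_cases)
      case (1 k' j i)
      then have "j = k" using e by (simp add: ehead_def)
      then have "\<not> input_reachable N m SA SB (Inl k')"
        using input_reachable_edge[of "Inl k'" "Inl k" i] G 1 k by (auto simp: S_def)
      then show ?thesis using 1 e tl by (auto simp: S_def etail_def)
    next
      case (2 k' j i)
      then have "j = k" using e by (simp add: ehead_def)
      moreover have "Inr (i, k') \<in> input_verts N m" using 2 by (auto simp: input_verts_def)
      ultimately have "input_reachable N m SA SB (Inl k)"
        using input_reachable_edge[of "Inr (i, k')" "Inl k" i] G 2 by auto
      then show ?thesis using k by (simp add: S_def)
    qed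
  qed
  then obtain ed f where "\<And>k. k \<in> S \<Longrightarrow>
      ed k \<in> Es \<and> etail (ed k) = Inl (f k) \<and> ehead (ed k) = Inl k \<and> f k \<in> S"
    by metis
  then have "cycles Es \<noteq> {}"
    using l not by (intro cycle_from_predecessors[of l S f ed]) (auto simp: S_def)
  then show False using st by (simp add: gen_stem_def)
qed

section \<open>From the graph to the realization\<close>

lemma structurally_controllable_if_reachable_and_matched:
  fixes SA :: "nat \<Rightarrow> 'n::finite \<Rightarrow> 'n \<Rightarrow> bool"
  assumes reach: "\<And>l. input_reachable N m SA SB (Inl l)"
    and edge: "\<And>l. (par l, Inl l, col l) \<in> Gc_edges N m SA SB"
    and inj: "\<And>l l'. par l = par l' \<Longrightarrow> col l = col l' \<Longrightarrow> l = l'"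
  shows "structurally_controllable N m SA SB"
proof -
  let ?R = "{(etail e, ehead e) | e. e \<in> Gc_edges N m SA SB}"
  have "\<exists>u. (Inr u, Inl l) \<in> ?R\<^sup>+" for l
    using reach[of l] unfolding input_reachable_def input_verts_def by blast
  from leveling_exists[OF this, of par] obtain lev dep entry q
    where lp: "leveled_parents par lev dep entry q" and R: "\<And>l. entry l \<Longrightarrow> (q l, Inl l) \<in> ?R" by blast
  have "\<forall>l. \<exists>i. entry l \<longrightarrow> (q l, Inl l, i) \<in> Gc_edges N m SA SB"
    using R by (fastforce simp: etail_def ehead_def)
  from choice[OF this] obtain qc where qedge: "\<And>l. entry l \<Longrightarrow> (q l, Inl l, qc l) \<in> Gc_edges N m SA SB"
    by blast
  interpret leveled_parents par lev dep entry q by (rule lp)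
  interpret colored_leveled_parents par lev dep entry q N m col qc
  proof
    fix l l' i h
    show "col l \<in> {1..N}" using edge[of l] by (auto simp: Gc_edges_def)
    show "par l = Inr (i, h) \<Longrightarrow> col l = i \<and> h < m i" using edge[of l] by (auto simp: Gc_edges_def)
    show "par l = par l' \<Longrightarrow> col l = col l' \<Longrightarrow> l = l'" by (rule inj)
    show "entry l \<Longrightarrow> qc l \<in> {1..N}" using qedge[of l] by (auto simp: Gc_edges_def)
    show "entry l \<Longrightarrow> q l = Inr (i, h) \<Longrightarrow> i \<in> {1..N} \<and> h < m i"
      using qedge[of l] by (auto simp: Gc_edges_def)
  qed
  obtain s where s: "\<And>W. \<not> uncontrollable_subspace s W" using controllable_parameter_exists by blast
  have "realizes N m SA SB (mode_mat s) (mode_inp s)"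
    unfolding realizes_def
  proof (intro conjI ballI allI impI)
    fix i j k assume "\<not> SA i j k"
    then have "\<not> (par j = Inl k \<and> col j = i)" "\<not> (entry j \<and> q j = Inl k \<and> qc j = i)"
      using edge[of j] qedge[of j] Gc_edges_iff(1) by metis+
    then show "mode_mat s i $ j $ k = 0" by (auto simp: mode_mat_def)
  next
    fix i j k assume "\<not> SB i j k"
    then have "par j \<noteq> Inr (i, k)" "\<not> (entry j \<and> q j = Inr (i, k))"
      using edge[of j] qedge[of j] Gc_edges_iff(2) by metis+
    then show "mode_inp s i j k = 0" by (auto simp: mode_inp_def)
  qed
  moreover have "switched_controllable N m (mode_mat s) (mode_inp s)"
  proof (rule switched_controllable_if_no_proper_invariant_subspace)
    fix W assume "subspace W" "\<And>i x. i \<in> {1..N} \<Longrightarrow> x \<in> W \<Longrightarrow> mode_mat s i *v x \<in> W"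
      "\<And>i v. i \<in> {1..N} \<Longrightarrow> inp_vec m (mode_inp s) i v \<in> W"
    then show "W = UNIV" using s[of W] unfolding uncontrollable_subspace_def by blast
  qed
  ultimately show ?thesis unfolding structurally_controllable_def by blast
qed

theorem theorem1:
  fixes N :: nat and m :: "nat \<Rightarrow> nat"
    and SA :: "nat \<Rightarrow> 'n::finite \<Rightarrow> 'n \<Rightarrow> bool" and SB :: "nat \<Rightarrow> 'n \<Rightarrow> nat \<Rightarrow> bool"
    and \<C> :: "('n vert set \<times> 'n cedge set) set"
  assumes "\<forall>g\<in>\<C>. gen_stem N m SA SB (fst g) (snd g) \<or> gen_bud N m SA SB (fst g) (snd g)"
    and "\<forall>g1\<in>\<C>. \<forall>g2\<in>\<C>. g1 \<noteq> g2 \<longrightarrow> fst g1 \<inter> fst g2 = {}"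
    and "state_verts \<subseteq> (\<Union>g\<in>\<C>. fst g)"
  shows "structurally_controllable N m SA SB"
proof -
  have sub: "is_subgraph N m SA SB (fst g) (snd g)" "one_ingoing (fst g) (snd g)" "S_disjoint (snd g)"
    if "g \<in> \<C>" for g
    using assms(1) that unfolding gen_stem_def gen_bud_def by auto
  \<comment> \<open>Each state gets a covering subgraph together with an ingoing edge in it, which
    serves as its parent edge.\<close>
  have "\<forall>l. \<exists>ge. fst ge \<in> \<C> \<and> Inl l \<in> fst (fst ge) \<and> snd ge \<in> snd (fst ge) \<and> ehead (snd ge) = Inl l"
  proof
    fix l :: 'n
    have l: "Inl l \<in> state_verts" by (simp add: state_verts_def)
    then obtain g where g: "g \<in> \<C>" "Inl l \<in> fst g" using assms(3) by blast
    then obtain e where "e \<in> snd g" "ehead e = Inl l"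
      using sub(2)[OF g(1)] l unfolding one_ingoing_def by blast
    then show "\<exists>ge. fst ge \<in> \<C> \<and> Inl l \<in> fst (fst ge) \<and> snd ge \<in> snd (fst ge) \<and> ehead (snd ge) = Inl l"
      using g by (intro exI[of _ "(g, e)"]) simp
  qed
  from choice[OF this] obtain ge where ge: "\<And>l. fst (ge l) \<in> \<C> \<and> Inl l \<in> fst (fst (ge l)) \<and>
      snd (ge l) \<in> snd (fst (ge l)) \<and> ehead (snd (ge l)) = Inl l" by blast
  define g where "g l = fst (ge l)" for l
  define e where "e l = snd (ge l)" for l
  have ge: "g l \<in> \<C>" "Inl l \<in> fst (g l)" "e l \<in> snd (g l)" "ehead (e l) = Inl l" for l
    using ge[of l] by (auto simp: g_def e_def)
  show ?thesis
  proof (rule structurally_controllable_if_reachable_and_matched)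
    fix l
    show "input_reachable N m SA SB (Inl l)"
      using assms(1) ge(1)[of l] ge(2)[of l] gen_stem_input_reachable
      unfolding gen_bud_def state_verts_def by blast
    have "e l \<in> Gc_edges N m SA SB"
      using sub(1)[OF ge(1)] ge(3) unfolding is_subgraph_def by blast
    moreover have "e l = (etail (e l), Inl l, ecolor (e l))"
      using ge(4)[of l] by (simp add: etail_def ehead_def ecolor_def prod_eq_iff)
    ultimately show "(etail (e l), Inl l, ecolor (e l)) \<in> Gc_edges N m SA SB" by simp
  next
    fix l l' assume eq: "etail (e l) = etail (e l')" "ecolor (e l) = ecolor (e l')"
    \<comment> \<open>A common tail is a vertex of both subgraphs, so vertex-disjointness makes them
      equal; S-disjointness inside that subgraph then identifies the two edges.\<close>
    have "etail (e l) \<in> fst (g l)" "etail (e l') \<in> fst (g l')"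
      using sub(1)[OF ge(1)] ge(3) unfolding is_subgraph_def by blast+
    then have "fst (g l) \<inter> fst (g l') \<noteq> {}" using eq(1) by auto
    then have "g l = g l'" using assms(2) ge(1) by blast
    then have "e l = e l'"
      using sub(3)[OF ge(1)[of l]] ge(3)[of l] ge(3)[of l'] eq unfolding S_disjoint_def by auto
    then show "l = l'" using ge(4) by (metis sum.inject(1))
  qed
qed

end
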